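(* Let $W$ be a compact connected Riemannian manifold with boundary, let $F:W\to\mathbb{R}$ be differentiable, and let $M^m$ be the compact Riemannian manifold with boundary defined by the graph $$M^m=\{(x,z):\ z=F(x),\ x\in W\}\subset W\times\mathbb{R}.$$ Viewed as a Riemannian isometric embedding into $W\times\mathbb{R}$ (with the product metric), the embedding constant $$C_M:=\sup_{p,q\in M}\big(d_M(p,q)-d_{W\times\mathbb{R}}(p,q)\big)$$ satisfies $$C_M\le 2\operatorname{diam}(W)\,\sup\{|\nabla F_x|:\ x\in W\}.$$
   Context: $M$ has the Riemannian metric induced from $W\times\mathbb{R}$; $d_M$ is the resulting Riemannian (intrinsic) distance on $M$ and $d_{W\times\mathbb{R}}$ is the distance of the product metric, where $W$ carries its intrinsic distance as a Riemannian manifold with boundary (infimum of lengths of curves in $W$). $\operatorname{diam}(W)$ is the diameter of $W$ with respect to this distance. $\nabla F_x$ denotes the gradient of $F$ at $x$. *)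

theory Defs
  imports "HOL-Analysis.Analysis"
begin

section \<open>Smooth functions on relatively open subsets of a half-space\<close>

text \<open>Derivatives are taken within the set. They are unique on relatively open subsets of a
  half-space, and there this notion of smoothness agrees with having local smooth extensions.\<close>

primrec Ck_on :: "nat \<Rightarrow> ('b::real_normed_vector \<Rightarrow> 'c::real_normed_vector) \<Rightarrow> 'b set \<Rightarrow> bool" where
  "Ck_on 0 f S \<longleftrightarrow> continuous_on S f"
| "Ck_on (Suc k) f S \<longleftrightarrow>
     (\<exists>D. (\<forall>x\<in>S. (f has_derivative D x) (at x within S)) \<and> (\<forall>v. Ck_on k (\<lambda>x. D x v) S))"

definition smooth_fun_on :: "('b::real_normed_vector \<Rightarrow> 'c::real_normed_vector) \<Rightarrow> 'b set \<Rightarrow> bool" where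
  "smooth_fun_on f S \<longleftrightarrow> (\<forall>k. Ck_on k f S)"


section \<open>Riemannian manifolds with boundary\<close>

text \<open>A tangent vector at \<open>p\<close> is represented by its coordinate vector in a chart around \<open>p\<close>;
  \<open>metric M i p v w\<close> is the inner product of the tangent vectors at \<open>p\<close> whose coordinates in the
  chart with index \<open>i\<close> are \<open>v\<close> and \<open>w\<close>.\<close>

record ('a, 'i, 'm) riem_data =
  mtop :: "'a topology"
  charts :: "'i set"
  dom :: "'i \<Rightarrow> 'a set"
  chart :: "'i \<Rightarrow> 'a \<Rightarrow> 'm"
  metric :: "'i \<Rightarrow> 'a \<Rightarrow> 'm \<Rightarrow> 'm \<Rightarrow> real"

definition param :: "('a, 'i, 'm) riem_data \<Rightarrow> 'i \<Rightarrow> 'm \<Rightarrow> 'a" where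
  "param M i = inv_into (dom M i) (chart M i)"

text \<open>The charts take values in closed half-spaces \<open>{v. 0 \<le> a \<bullet> v}\<close>, whose direction \<open>a\<close> may depend
  on the chart; a chart whose image avoids the hyperplane \<open>a \<bullet> v = 0\<close> is an interior chart.\<close>

locale riemannian_manifold_with_boundary =
  fixes M :: "('a, 'i, 'm::euclidean_space) riem_data"
  assumes hausdorff: "Hausdorff_space (mtop M)"
    and countable_base: "second_countable (mtop M)"
    and cover: "topspace (mtop M) = (\<Union>i\<in>charts M. dom M i)"
    and dom_open: "i \<in> charts M \<Longrightarrow> openin (mtop M) (dom M i)"
    and chart_image: "i \<in> charts M \<Longrightarrow>
      \<exists>a. a \<noteq> 0 \<and> openin (top_of_set {v. 0 \<le> a \<bullet> v}) (chart M i ` dom M i)"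
    and chart_homeo: "i \<in> charts M \<Longrightarrow>
      homeomorphic_map (subtopology (mtop M) (dom M i)) (top_of_set (chart M i ` dom M i)) (chart M i)"
    and transition_smooth: "\<lbrakk>i \<in> charts M; j \<in> charts M\<rbrakk> \<Longrightarrow>
      smooth_fun_on (chart M j \<circ> param M i) (chart M i ` (dom M i \<inter> dom M j))"
    and metric_bilinear: "\<lbrakk>i \<in> charts M; p \<in> dom M i\<rbrakk> \<Longrightarrow> bilinear (metric M i p)"
    and metric_sym: "\<lbrakk>i \<in> charts M; p \<in> dom M i\<rbrakk> \<Longrightarrow> metric M i p v w = metric M i p w v"
    and metric_pos: "\<lbrakk>i \<in> charts M; p \<in> dom M i; v \<noteq> 0\<rbrakk> \<Longrightarrow> 0 < metric M i p v v"
    and metric_smooth: "i \<in> charts M \<Longrightarrow>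
      smooth_fun_on (\<lambda>u. metric M i (param M i u) v w) (chart M i ` dom M i)"
    and metric_compat: "\<lbrakk>i \<in> charts M; j \<in> charts M; p \<in> dom M i; p \<in> dom M j;
        ((chart M j \<circ> param M i) has_derivative D)
          (at (chart M i p) within chart M i ` (dom M i \<inter> dom M j))\<rbrakk> \<Longrightarrow>
      metric M i p v w = metric M j p (D v) (D w)"

text \<open>An arbitrary chart around \<open>p\<close>. By compatibility of the metric, the norms computed below in this
  chart do not depend on the choice.\<close>

definition chart_at :: "('a, 'i, 'm) riem_data \<Rightarrow> 'a \<Rightarrow> 'i" where
  "chart_at M p = (SOME i. i \<in> charts M \<and> p \<in> dom M i)"


section \<open>Differentiable functions and gradients\<close>

definition differentiable_fun :: "('a, 'i, 'm::euclidean_space) riem_data \<Rightarrow> ('a \<Rightarrow> real) \<Rightarrow> bool" where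
  "differentiable_fun M F \<longleftrightarrow>
     (\<forall>i\<in>charts M. (F \<circ> param M i) differentiable_on (chart M i ` dom M i))"

definition differential :: "('a, 'i, 'm::euclidean_space) riem_data \<Rightarrow> ('a \<Rightarrow> real) \<Rightarrow> 'a \<Rightarrow> 'm \<Rightarrow> real" where
  "differential M F p = (let i = chart_at M p in
     frechet_derivative (F \<circ> param M i) (at (chart M i p) within chart M i ` dom M i))"

definition gradient :: "('a, 'i, 'm::euclidean_space) riem_data \<Rightarrow> ('a \<Rightarrow> real) \<Rightarrow> 'a \<Rightarrow> 'm" where
  "gradient M F p = (THE n. \<forall>v. metric M (chart_at M p) p n v = differential M F p v)"

definition tnorm :: "('a, 'i, 'm) riem_data \<Rightarrow> 'a \<Rightarrow> 'm \<Rightarrow> real" where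
  "tnorm M p v = sqrt (metric M (chart_at M p) p v v)"


section \<open>Curves, lengths and distances\<close>

text \<open>Curves are continuous and differentiable at all but finitely many parameters. Such a curve with
  integrable speed is absolutely continuous, so the integral of the speed is its length, and the
  infimum of lengths is the same as over piecewise \<open>C\<^sup>1\<close> curves. The advantage over the latter class is
  that it is preserved by lifting to the graph of a function that is differentiable but not \<open>C\<^sup>1\<close>.\<close>

definition curve :: "('a, 'i, 'm::euclidean_space) riem_data \<Rightarrow> (real \<Rightarrow> 'a) \<Rightarrow> bool" where
  "curve M c \<longleftrightarrow> continuous_map (top_of_set {0..1}) (mtop M) c \<and>
     (\<exists>E. finite E \<and> (\<forall>t\<in>{0<..<1} - E. \<forall>i\<in>charts M. c t \<in> dom M i \<longrightarrow>
        (chart M i \<circ> c) differentiable (at t)))"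

definition velocity :: "('a, 'i, 'm::euclidean_space) riem_data \<Rightarrow> (real \<Rightarrow> 'a) \<Rightarrow> real \<Rightarrow> 'm" where
  "velocity M c t = vector_derivative (chart M (chart_at M (c t)) \<circ> c) (at t)"

definition curve_length :: "('a, 'i, 'm::euclidean_space) riem_data \<Rightarrow> (real \<Rightarrow> 'a) \<Rightarrow> ereal" where
  "curve_length M c =
     enn2ereal (\<integral>\<^sup>+t\<in>{0<..<1}. ennreal (tnorm M (c t) (velocity M c t)) \<partial>lborel)"

text \<open>For a submanifold \<open>S\<close> of \<open>M\<close> with the induced metric, the velocity of a curve in \<open>S\<close> has the same
  norm in \<open>S\<close> as in \<open>M\<close>, so \<open>dist_in M S\<close> is the intrinsic Riemannian distance of \<open>S\<close>. It is infinite
  between points of \<open>S\<close> not joined by a curve in \<open>S\<close>.\<close>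

definition dist_in :: "('a, 'i, 'm::euclidean_space) riem_data \<Rightarrow> 'a set \<Rightarrow> 'a \<Rightarrow> 'a \<Rightarrow> ereal" where
  "dist_in M S p q =
     (INF c\<in>{c. curve M c \<and> c ` {0..1} \<subseteq> S \<and> c 0 = p \<and> c 1 = q}. curve_length M c)"

definition riem_dist :: "('a, 'i, 'm::euclidean_space) riem_data \<Rightarrow> 'a \<Rightarrow> 'a \<Rightarrow> ereal" where
  "riem_dist M = dist_in M (topspace (mtop M))"

definition riem_diam :: "('a, 'i, 'm::euclidean_space) riem_data \<Rightarrow> ereal" where
  "riem_diam M = (SUP x\<in>topspace (mtop M). SUP y\<in>topspace (mtop M). riem_dist M x y)"

definition embedding_constant :: "('a, 'i, 'm::euclidean_space) riem_data \<Rightarrow> 'a set \<Rightarrow> ereal" where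
  "embedding_constant N S = (SUP p\<in>S. SUP q\<in>S. dist_in N S p q - riem_dist N p q)"


section \<open>The Riemannian product with the real line, and graphs\<close>

definition times_real :: "('a, 'i, 'm::euclidean_space) riem_data \<Rightarrow> ('a \<times> real, 'i, 'm \<times> real) riem_data" where
  "times_real W =
     \<lparr>mtop = prod_topology (mtop W) euclideanreal,
      charts = charts W,
      dom = (\<lambda>i. dom W i \<times> UNIV),
      chart = (\<lambda>i (x, z). (chart W i x, z)),
      metric = (\<lambda>i (x, z) (v, s) (w, r). metric W i x v w + s * r)\<rparr>"

definition graph_of :: "('a, 'i, 'm) riem_data \<Rightarrow> ('a \<Rightarrow> real) \<Rightarrow> ('a \<times> real) set" where
  "graph_of W F = {(x, z). x \<in> topspace (mtop W) \<and> z = F x}"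

end

theory Submission
  imports Defs
begin

text \<open>
Let \<open>G\<close> be the supremum of the gradient norms. Lifting a curve \<open>c\<close> in \<open>W\<close> to the curve \<open>(c, F \<circ> c)\<close>
in the graph replaces its speed \<open>s\<close> by at most \<open>s + G s\<close>, since \<open>\<bar>(F \<circ> c)'\<bar> = \<bar>dF(c')\<bar> \<le> G s\<close>; hence
\<open>d\<^sub>M((x, F x), (y, F y)) \<le> (1 + G) d\<^sub>W(x, y)\<close> (\<open>dist_in_graph_le\<close>). Projecting a curve of
\<open>W \<times> \<real>\<close> to \<open>W\<close> cannot increase its speed, so the distance in the product is at least \<open>d\<^sub>W(x, y)\<close>
(\<open>riem_dist_le_times_real\<close>). The difference is therefore at most \<open>G d\<^sub>W(x, y) \<le> G diam(W)\<close>, half of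
the claimed bound.

Two points need care because distances are extended reals. The subtraction
\<open>(1 + G) d\<^sub>W - d\<^sub>W = G d\<^sub>W\<close> requires \<open>d\<^sub>W(x, y) < \<infinity>\<close>. This comes from connectedness: in a chart, any
two points near a given one are joined by a coordinate segment, along which the speed is bounded,
and such paths can be concatenated (\<open>connected_imp_joined\<close>). And \<open>F\<close> is only differentiable, so \<open>G\<close>
may be infinite; then the right-hand side is \<open>\<infinity>\<close> only if \<open>diam(W) \<noteq> 0\<close>. That is proved with a bump
function supported in a chart: its change along a curve is at most a constant times the length,
so two points where it differs have positive distance (\<open>riem_diam_pos\<close>).

The integral defining the length of a curve is a lower integral, which makes sense without
measurability of the speed. The few facts on integrals that are used are proved in this generality,
so measurability of the speed never has to be established.\<close>

section \<open>Integral estimates without measurability\<close>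

text \<open>Scaling by \<open>k\<close> is a bijection between the simple functions below \<open>f\<close> and those below \<open>k f\<close>, so
  the lower integral is homogeneous for arbitrary, possibly non-measurable, functions.\<close>
lemma nn_integral_scale_le:
  fixes f g :: "'b \<Rightarrow> ennreal" and k :: real
  assumes "0 < k" and ae: "AE x in M. g x \<le> ennreal k * f x"
  shows "integral\<^sup>N M g \<le> ennreal k * integral\<^sup>N M f"
proof -
  have kk: "ennreal k * ennreal (1 / k) = 1"
    using \<open>0 < k\<close> by (simp flip: ennreal_mult')
  have "(\<integral>\<^sup>+x. ennreal k * f x \<partial>M) \<le> ennreal k * integral\<^sup>N M f"
    unfolding nn_integral_def[of M "\<lambda>x. ennreal k * f x"]
  proof (intro SUP_least, safe)
    fix s assume s: "simple_function M s" "s \<le> (\<lambda>x. ennreal k * f x)"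
    define r where "r x = ennreal (1 / k) * s x" for x
    have r: "simple_function M r"
      unfolding r_def using s(1) by simp
    have "r x \<le> f x" for x
    proof -
      have "r x \<le> ennreal (1 / k) * (ennreal k * f x)"
        unfolding r_def using s(2) by (intro mult_left_mono) (auto simp: le_fun_def)
      also have "\<dots> = f x"
        using kk by (metis mult.assoc mult.commute mult_1)
      finally show ?thesis .
    qed
    have "s = (\<lambda>x. ennreal k * r x)"
      unfolding r_def using kk by (metis mult.assoc mult_1)
    then have "integral\<^sup>S M s = ennreal k * integral\<^sup>S M r"
      using simple_integral_mult[OF r, of "ennreal k"] by simp
    also have "\<dots> = ennreal k * integral\<^sup>N M r"
      using nn_integral_eq_simple_integral[OF r] by simp
    also have "\<dots> \<le> ennreal k * integral\<^sup>N M f"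
      by (intro mult_left_mono nn_integral_mono) (use \<open>\<And>x. r x \<le> f x\<close> in auto)
    finally show "integral\<^sup>S M s \<le> ennreal k * integral\<^sup>N M f" .
  qed
  with nn_integral_mono_AE[OF ae] show ?thesis
    by (rule order_trans)
qed

text \<open>The derivative \<open>d\<close> of \<open>f\<close> is gauge integrable with integral \<open>f 1 - f 0\<close>, hence Lebesgue measurable.
  If \<open>\<bar>d\<bar>\<close> has finite Lebesgue integral, both integrals of \<open>d\<close> agree; otherwise the right-hand side is
  infinite. Only \<open>d\<close> has to be measurable; the bound \<open>g\<close> is arbitrary.\<close>
lemma abs_diff_le_nn_integral:
  fixes f :: "real \<Rightarrow> real" and g :: "real \<Rightarrow> ennreal"
  assumes E: "finite E" and f: "continuous_on {0..1} f"
    and der: "\<And>t. t \<in> {0<..<1} - E \<Longrightarrow>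
      \<exists>d. (f has_vector_derivative d) (at t) \<and> ennreal \<bar>d\<bar> \<le> g t"
  shows "ennreal \<bar>f 1 - f 0\<bar> \<le> (\<integral>\<^sup>+t\<in>{0<..<1}. g t \<partial>lborel)"
proof -
  obtain d where d: "\<And>t. t \<in> {0<..<1} - E \<Longrightarrow> (f has_vector_derivative d t) (at t)"
    and dg: "\<And>t. t \<in> {0<..<1} - E \<Longrightarrow> ennreal \<bar>d t\<bar> \<le> g t"
    using der by metis
  have int: "(d has_integral (f 1 - f 0)) {0..1}"
    using fundamental_theorem_of_calculus_interior_strong[OF E _ d f] by simp
  define h where "h t = d t * indicator {0..1} t" for t :: real
  have h: "h \<in> lebesgue \<rightarrow>\<^sub>M borel"
    unfolding h_def using has_integral_implies_lebesgue_measurable_real[OF int] .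
  have "(\<lambda>t. if t \<in> {0..1} then d t else 0) = h"
    by (auto simp: h_def)
  then have h_int: "(h has_integral (f 1 - f 0)) UNIV"
    using int has_integral_restrict_UNIV[of "{0..1}" d] by metis
  \<comment> \<open>Only \<open>t \<notin> E \<union> {0, 1}\<close> matters, and there \<open>\<bar>h t\<bar>\<close> is at most the integrand on the right.\<close>
  have "finite (E \<union> {0, 1})"
    using E by simp
  then have "AE t in lborel. t \<notin> E \<union> {0, 1}"
    by (intro AE_lborel_singleton AE_not_in finite_imp_null_set_lborel)
  then have le: "(\<integral>\<^sup>+t. ennreal (norm (h t)) \<partial>lborel) \<le> (\<integral>\<^sup>+t\<in>{0<..<1}. g t \<partial>lborel)"
    by (intro nn_integral_mono_AE, elim eventually_mono)
      (auto simp: h_def indicator_def intro!: dg)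
  show ?thesis
  proof (cases "(\<integral>\<^sup>+t. ennreal (norm (h t)) \<partial>lborel) = \<infinity>")
    case True
    with le show ?thesis by (simp add: top_unique)
  next
    case False
    then have "(\<integral>\<^sup>+t. ennreal (norm (h t)) \<partial>lebesgue) < \<infinity>"
      by (simp add: nn_integral_completion top.not_eq_extremum)
    then have i: "integrable lebesgue h"
      using h by (simp add: integrable_iff_bounded)
    then have "integral\<^sup>L lebesgue h = f 1 - f 0"
      using has_integral_integral_lebesgue h_int has_integral_unique by blast
    then have "ennreal \<bar>f 1 - f 0\<bar> \<le> (\<integral>\<^sup>+t. ennreal (norm (h t)) \<partial>lebesgue)"
      using integral_norm_bound_ennreal[OF i] by simp
    with le show ?thesis
      by (simp add: nn_integral_completion)
  qed
qed

section \<open>Inner products, derivatives of compositions\<close>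

lemma positive_bilinear_Cauchy_Schwarz:
  fixes B :: "'m::real_vector \<Rightarrow> 'm \<Rightarrow> real"
  assumes lin: "\<And>x. linear (B x)" "\<And>y. linear (\<lambda>x. B x y)"
    and sym: "\<And>x y. B x y = B y x" and pos: "\<And>x. x \<noteq> 0 \<Longrightarrow> 0 < B x x"
  shows "\<bar>B x y\<bar> \<le> sqrt (B x x) * sqrt (B y y)"
proof (cases "y = 0")
  case True
  then show ?thesis
    using linear_0[OF lin(1)] by simp
next
  case False
  then have y: "0 < B y y"
    by (rule pos)
  \<comment> \<open>\<open>s y\<close> is the orthogonal projection of \<open>x\<close> to the line of \<open>y\<close>; expand \<open>B (x - s y) (x - s y) \<ge> 0\<close>.\<close>
  define s where "s = B x y / B y y"
  have nonneg: "0 \<le> B z z" for z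
    using pos[of z] linear_0[OF lin(1), of 0] by (cases "z = 0") auto
  have "B (x - s *\<^sub>R y) (x - s *\<^sub>R y) = B x x - 2 * s * B x y + s\<^sup>2 * B y y"
    by (simp add: linear_diff[OF lin(1)] linear_diff[OF lin(2)] linear_scale[OF lin(1)]
        linear_scale[OF lin(2)] sym[of y x] power2_eq_square algebra_simps)
  also have "\<dots> = B x x - (B x y)\<^sup>2 / B y y"
    using y by (simp add: s_def power2_eq_square field_simps)
  finally have "(B x y)\<^sup>2 / B y y \<le> B x x"
    using nonneg[of "x - s *\<^sub>R y"] by simp
  then have "(B x y)\<^sup>2 \<le> B x x * B y y"
    using y by (simp add: pos_divide_le_eq)
  then have "sqrt ((B x y)\<^sup>2) \<le> sqrt (B x x * B y y)"
    by (rule real_sqrt_le_mono)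
  then show ?thesis
    by (simp add: real_sqrt_mult)
qed

text \<open>The map sending \<open>n\<close> to the coordinates of \<open>B n\<close> is linear and, by definiteness, injective, so it is
  onto in finite dimension. This makes the description that defines the gradient meaningful.\<close>
lemma riesz_representation_bilinear:
  fixes B :: "'m::euclidean_space \<Rightarrow> 'm \<Rightarrow> real"
  assumes lin: "\<And>x. linear (B x)" "\<And>y. linear (\<lambda>x. B x y)"
    and pos: "\<And>x. x \<noteq> 0 \<Longrightarrow> 0 < B x x" and D: "linear D"
  shows "\<exists>!n. \<forall>v. B n v = D v"
proof -
  define T where "T n = (\<Sum>b\<in>Basis. B n b *\<^sub>R b)" for n
  have T: "linear T"
    by (rule linearI) (simp_all add: T_def linear_add[OF lin(2)] linear_scale[OF lin(2)]
        scaleR_add_left sum.distrib scaleR_sum_right)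
  have eq: "B n v = D v" if n: "T n = (\<Sum>b\<in>Basis. D b *\<^sub>R b)" for n v
  proof -
    have "B n b = D b" if "b \<in> Basis" for b
      using arg_cong[OF n, of "\<lambda>z. z \<bullet> b"] that by (simp add: T_def inner_sum_left_Basis)
    then show ?thesis
      using linear_eq_stdbasis[OF lin(1) D] by metis
  qed
  have zero: "n = 0" if "\<And>v. B n v = 0" for n
    using pos[of n] that[of n] by auto
  have "inj T"
  proof (subst linear_injective_0[OF T], safe)
    fix n assume n: "T n = 0"
    have "B n b = 0" if "b \<in> Basis" for b
      using arg_cong[OF n, of "\<lambda>z. z \<bullet> b"] that by (simp add: T_def inner_sum_left_Basis)
    then have "B n = (\<lambda>v. 0)"
      using linear_eq_stdbasis[OF lin(1) linear_zero, of n] by metis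
    then show "n = 0"
      using zero by metis
  qed
  then have "surj T"
    using T by (intro linear_injective_imp_surjective refl)
  then obtain n where "T n = (\<Sum>b\<in>Basis. D b *\<^sub>R b)"
    by (metis surjD)
  then have n: "\<forall>v. B n v = D v"
    using eq by blast
  show ?thesis
  proof (rule ex1I[of _ n])
    fix n' assume n': "\<forall>v. B n' v = D v"
    have "B (n' - n) v = 0" for v
      using n n' by (simp add: linear_diff[OF lin(2)])
    then show "n' = n"
      using zero[of "n' - n"] by simp
  qed (rule n)
qed

text \<open>Squaring smooths the corner of the positive part; this is the profile of the bump function below.\<close>
lemma has_real_derivative_square_pos_part:
  "((\<lambda>s. (max 0 s)\<^sup>2) has_real_derivative 2 * max 0 s) (at s)"
proof -
  consider "s < 0" | "s = 0" | "0 < s" by linarith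
  then show ?thesis
  proof cases
    case 1
    have "((\<lambda>s. 0) has_real_derivative 2 * max 0 s) (at s)"
      using 1 by simp
    then show ?thesis
      by (rule has_field_derivative_transform_within_open[where S = "{..<0}"]) (use 1 in auto)
  next
    case 2
    have "((\<lambda>h. (max 0 h)\<^sup>2 / h) \<longlongrightarrow> 0) (at (0::real))"
    proof (rule Lim_null_comparison)
      show "\<forall>\<^sub>F h in at (0::real). norm ((max 0 h)\<^sup>2 / h) \<le> \<bar>h\<bar>"
        by (auto simp: max_def power2_eq_square)
      show "((\<lambda>h. \<bar>h\<bar>) \<longlongrightarrow> 0) (at (0::real))"
        by (rule tendsto_eq_intros | simp)+
    qed
    then show ?thesis
      using 2 by (simp add: DERIV_def)
  next
    case 3
    have "((\<lambda>s. s\<^sup>2) has_real_derivative 2 * max 0 s) (at s)"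
      using 3 by (auto intro!: derivative_eq_intros)
    then show ?thesis
      by (rule has_field_derivative_transform_within_open[where S = "{0<..}"]) (use 3 in auto)
  qed
qed

text \<open>Chain rule for an outer function differentiable only within \<open>S\<close>, as happens at the boundary of a
  half-space: it is enough that the curve stays in \<open>S\<close> near \<open>t\<close>.\<close>
lemma has_vector_derivative_compose_within:
  assumes g: "(g has_derivative D) (at (f t) within S)"
    and f: "(f has_vector_derivative v) (at t)" and S: "\<forall>\<^sub>F s in nhds t. f s \<in> S"
  shows "((g \<circ> f) has_vector_derivative D v) (at t)"
proof -
  obtain U where U: "open U" "t \<in> U" "\<And>s. s \<in> U \<Longrightarrow> f s \<in> S"
    using S by (auto simp: eventually_nhds)
  have "(g has_derivative D) (at (f t) within f ` U)"
    by (rule has_derivative_subset[OF g]) (use U in auto)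
  moreover have "(f has_vector_derivative v) (at t within U)"
    using f by (rule has_vector_derivative_at_within)
  ultimately have "((g \<circ> f) has_derivative (D \<circ> (\<lambda>x. x *\<^sub>R v))) (at t within U)"
    unfolding has_vector_derivative_def by (intro diff_chain_within)
  moreover have "D \<circ> (\<lambda>x. x *\<^sub>R v) = (\<lambda>x. x *\<^sub>R D v)"
    using linear_scale[OF has_derivative_linear[OF g]] by auto
  ultimately show ?thesis
    unfolding has_vector_derivative_def at_within_open[OF U(2,1)] by simp
qed

lemma has_vector_derivative_cong_nhds:
  assumes "(f has_vector_derivative d) (at t)" and "\<forall>\<^sub>F s in nhds t. f s = g s"
  shows "(g has_vector_derivative d) (at t)"
proof -
  have "\<forall>\<^sub>F x in at t. f x = g x" "f t = g t"
    using assms(2) by (auto simp: eventually_nhds eventually_at_filter)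
  then show ?thesis
    using assms(1) unfolding has_vector_derivative_def
    by (intro has_derivative_transform_eventually[of f _ t UNIV g]) auto
qed

lemma has_vector_derivative_affine_reparam:
  assumes f: "(f has_vector_derivative v) (at (2 * t - b))"
    and g: "\<forall>\<^sub>F s in nhds t. g s = f (2 * s - b)"
  shows "(g has_vector_derivative 2 *\<^sub>R v) (at (t::real))"
proof -
  have "((\<lambda>s. 2 * s - b) has_vector_derivative 2) (at t)"
    by (auto intro!: derivative_eq_intros)
  from vector_diff_chain_at[OF this f] have "(f \<circ> (\<lambda>s. 2 * s - b) has_vector_derivative 2 *\<^sub>R v) (at t)"
    by simp
  then show ?thesis
    by (rule has_vector_derivative_cong_nhds) (rule eventually_mono[OF g], simp)
qed

section \<open>Charts and the metric along curves\<close>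

lemma eventually_curve_in_open:
  assumes c: "continuous_map (top_of_set {0..1}) X c" and t: "t \<in> {0<..<1::real}"
    and U: "openin X U" "c t \<in> U"
  shows "\<forall>\<^sub>F s in nhds t. c s \<in> U"
proof -
  have "openin (top_of_set {0..1}) {s \<in> {0..1}. c s \<in> U}"
    using openin_continuous_map_preimage[OF c U(1)] by simp
  then obtain V where V: "open V" "{s \<in> {0..1}. c s \<in> U} = {0..1} \<inter> V"
    by (auto simp: openin_open)
  have "t \<in> {0..1} \<inter> V"
    using t U(2) unfolding V(2)[symmetric] by simp
  then have "open (V \<inter> {0<..<1})" "t \<in> V \<inter> {0<..<1}"
    using V(1) t by auto
  then have "\<forall>\<^sub>F s in nhds t. s \<in> V \<inter> {0<..<1}"
    by (rule eventually_nhds_in_open)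
  then show ?thesis
  proof (rule eventually_mono)
    fix s assume "s \<in> V \<inter> {0<..<1}"
    then have "s \<in> {0..1} \<inter> V" by simp
    then show "c s \<in> U" unfolding V(2)[symmetric] by simp
  qed
qed

context riemannian_manifold_with_boundary
begin

lemma dom_subset: "i \<in> charts M \<Longrightarrow> dom M i \<subseteq> topspace (mtop M)"
  by (rule openin_subset[OF dom_open])

lemma topspace_dom: "i \<in> charts M \<Longrightarrow> topspace (subtopology (mtop M) (dom M i)) = dom M i"
  using dom_subset[of i] by auto

lemma chart_inj: "i \<in> charts M \<Longrightarrow> inj_on (chart M i) (dom M i)"
  using homeomorphic_imp_injective_map[OF chart_homeo, of i] by (simp only: topspace_dom)

lemma param_chart: "\<lbrakk>i \<in> charts M; p \<in> dom M i\<rbrakk> \<Longrightarrow> param M i (chart M i p) = p"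
  unfolding param_def by (rule inv_into_f_f[OF chart_inj])

lemma param_in_dom: "u \<in> chart M i ` dom M i \<Longrightarrow> param M i u \<in> dom M i"
  unfolding param_def by (rule inv_into_into)

lemma chart_param: "u \<in> chart M i ` dom M i \<Longrightarrow> chart M i (param M i u) = u"
  unfolding param_def by (rule f_inv_into_f)

lemma chart_continuous:
  assumes "i \<in> charts M"
  shows "continuous_map (subtopology (mtop M) (dom M i)) euclidean (chart M i)"
  using homeomorphic_imp_continuous_map[OF chart_homeo[OF assms]]
  by (simp only: continuous_map_in_subtopology)

lemma param_continuous:
  assumes i: "i \<in> charts M"
  shows "continuous_map (top_of_set (chart M i ` dom M i)) (mtop M) (param M i)"
proof -
  obtain g where g: "homeomorphic_maps (subtopology (mtop M) (dom M i))
      (top_of_set (chart M i ` dom M i)) (chart M i) g"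
    using chart_homeo[OF i] homeomorphic_map_maps by blast
  have "g u = param M i u" if "u \<in> chart M i ` dom M i" for u
    using g that param_chart[OF i] unfolding homeomorphic_maps_def topspace_dom[OF i] by auto
  moreover have "continuous_map (top_of_set (chart M i ` dom M i)) (mtop M) g"
    using g unfolding homeomorphic_maps_def by (simp add: continuous_map_in_subtopology)
  ultimately show ?thesis
    by (rule continuous_map_eq[rotated]) auto
qed

lemma openin_chart_preimage:
  assumes i: "i \<in> charts M" and V: "open V"
  shows "openin (mtop M) {p \<in> dom M i. chart M i p \<in> V}"
proof -
  have "openin (subtopology (mtop M) (dom M i)) {p \<in> dom M i. chart M i p \<in> V}"
    using openin_continuous_map_preimage[OF chart_continuous[OF i], of V, unfolded topspace_dom[OF i]] V
    by simp
  then show ?thesis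
    using dom_open[OF i] by (rule openin_trans_full)
qed

lemma chart_at_in:
  assumes "p \<in> topspace (mtop M)"
  shows "chart_at M p \<in> charts M" "p \<in> dom M (chart_at M p)"
proof -
  have "\<exists>i. i \<in> charts M \<and> p \<in> dom M i"
    using assms cover by auto
  from someI_ex[OF this] show "chart_at M p \<in> charts M" "p \<in> dom M (chart_at M p)"
    unfolding chart_at_def by auto
qed

text \<open>Differentiate the transition map along the curve; the metrics correspond under its derivative.\<close>
lemma derivative_in_other_chart:
  assumes i: "i \<in> charts M" and j: "j \<in> charts M" and c: "\<forall>\<^sub>F s in nhds t. c s \<in> dom M i \<inter> dom M j"
    and v: "((chart M i \<circ> c) has_vector_derivative v) (at t)"
  obtains w where "((chart M j \<circ> c) has_vector_derivative w) (at t)"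
    and "metric M j (c t) w w = metric M i (c t) v v"
proof -
  let ?S = "chart M i ` (dom M i \<inter> dom M j)"
  have t: "c t \<in> dom M i" "c t \<in> dom M j"
    using eventually_nhds_x_imp_x[OF c] by auto
  have "Ck_on (Suc 0) (chart M j \<circ> param M i) ?S"
    using transition_smooth[OF i j] unfolding smooth_fun_on_def by blast
  then obtain D where D: "((chart M j \<circ> param M i) has_derivative D) (at (chart M i (c t)) within ?S)"
    using t by (auto simp del: Ck_on.simps simp: Ck_on.simps(2))
  have "((chart M j \<circ> param M i) \<circ> (chart M i \<circ> c) has_vector_derivative D v) (at t)"
  proof (rule has_vector_derivative_compose_within[OF _ v])
    show "((chart M j \<circ> param M i) has_derivative D) (at ((chart M i \<circ> c) t) within ?S)"
      using D by simp
    show "\<forall>\<^sub>F s in nhds t. (chart M i \<circ> c) s \<in> ?S"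
      using c by (rule eventually_mono) auto
  qed
  then have "((chart M j \<circ> c) has_vector_derivative D v) (at t)"
    by (rule has_vector_derivative_cong_nhds)
      (rule eventually_mono[OF c], simp add: param_chart[OF i])
  moreover have "metric M j (c t) (D v) (D v) = metric M i (c t) v v"
    using metric_compat[OF i j t D] by simp
  ultimately show thesis
    by (rule that)
qed

text \<open>The speed is defined through an arbitrarily chosen chart around \<open>c t\<close>. It may be computed in any
  chart, and differentiability of \<open>c\<close> in one chart gives it in all others.\<close>
lemma speed_in_chart:
  assumes c: "continuous_map (top_of_set {0..1}) (mtop M) c" and t: "t \<in> {0<..<1::real}"
    and i: "i \<in> charts M" "c t \<in> dom M i"
    and v: "((chart M i \<circ> c) has_vector_derivative v) (at t)"
  shows "tnorm M (c t) (velocity M c t) = sqrt (metric M i (c t) v v)"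
    and "\<lbrakk>j \<in> charts M; c t \<in> dom M j\<rbrakk> \<Longrightarrow> (chart M j \<circ> c) differentiable (at t)"
proof -
  have ev: "\<forall>\<^sub>F s in nhds t. c s \<in> dom M i \<inter> dom M j" if "j \<in> charts M" "c t \<in> dom M j" for j
    by (rule eventually_curve_in_open[OF c t]) (use that i dom_open in auto)
  show "(chart M j \<circ> c) differentiable (at t)" if "j \<in> charts M" "c t \<in> dom M j"
    by (rule derivative_in_other_chart[OF i(1) that(1) ev[OF that] v])
      (auto simp: has_vector_derivative_def differentiable_def)
  let ?j = "chart_at M (c t)"
  have j: "?j \<in> charts M" "c t \<in> dom M ?j"
    using chart_at_in[of "c t"] i dom_subset[of i] by auto
  obtain w where "((chart M ?j \<circ> c) has_vector_derivative w) (at t)"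
    and w: "metric M ?j (c t) w w = metric M i (c t) v v"
    using derivative_in_other_chart[OF i(1) j(1) ev[OF j] v] .
  then have "velocity M c t = w"
    unfolding velocity_def by (intro vector_derivative_at)
  with w show "tnorm M (c t) (velocity M c t) = sqrt (metric M i (c t) v v)"
    by (simp add: tnorm_def)
qed

lemma metric_linear:
  assumes "i \<in> charts M" "p \<in> dom M i"
  shows "linear (metric M i p v)" "linear (\<lambda>v. metric M i p v w)"
  using metric_bilinear[OF assms] unfolding bilinear_def by simp_all

lemma metric_nonneg:
  assumes "i \<in> charts M" "p \<in> dom M i"
  shows "0 \<le> metric M i p v v"
proof (cases "v = 0")
  case True
  then show ?thesis
    using linear_0[OF metric_linear(1)[OF assms], of 0] by simp
next
  case False
  then show ?thesis
    using metric_pos[OF assms] by (simp add: less_imp_le)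
qed

lemma tnorm_nonneg: "p \<in> topspace (mtop M) \<Longrightarrow> 0 \<le> tnorm M p v"
  unfolding tnorm_def by (intro real_sqrt_ge_zero metric_nonneg chart_at_in)

lemma metric_continuous:
  assumes "i \<in> charts M"
  shows "continuous_on (chart M i ` dom M i) (\<lambda>u. metric M i (param M i u) v w)"
proof -
  have "Ck_on 0 (\<lambda>u. metric M i (param M i u) v w) (chart M i ` dom M i)"
    using metric_smooth[OF assms] unfolding smooth_fun_on_def by (rule spec)
  then show ?thesis
    by (simp only: Ck_on.simps(1))
qed

text \<open>Cauchy-Schwarz, once the gradient is known to represent the differential.\<close>
lemma differential_le_gradient:
  assumes F: "differentiable_fun M F" and p: "p \<in> topspace (mtop M)"
  shows "\<bar>differential M F p v\<bar> \<le> tnorm M p (gradient M F p) * tnorm M p v"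
proof -
  let ?i = "chart_at M p" let ?B = "metric M ?i p"
  note i = chart_at_in[OF p]
  have "(F \<circ> param M ?i) differentiable (at (chart M ?i p) within chart M ?i ` dom M ?i)"
    using F i unfolding differentiable_fun_def differentiable_on_def by simp
  then have "linear (differential M F p)"
    unfolding differential_def Let_def frechet_derivative_works by (rule has_derivative_linear)
  then have "\<exists>!n. \<forall>v. ?B n v = differential M F p v"
    by (intro riesz_representation_bilinear metric_linear[OF i] metric_pos[OF i])
  from theI'[OF this] have "differential M F p v = ?B (gradient M F p) v"
    unfolding gradient_def by simp
  then show ?thesis
    unfolding tnorm_def
    using positive_bilinear_Cauchy_Schwarz[of ?B, OF metric_linear[OF i] metric_sym[OF i] metric_pos[OF i]]
    by simp
qed

end

section \<open>Lifting curves to the graph and projecting them from the product\<close>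

lemma curve_length_scale_le:
  assumes "finite E" and "0 < k"
    and speed: "\<And>t. t \<in> {0<..<1} - E \<Longrightarrow>
      tnorm N (d t) (velocity N d t) \<le> k * tnorm M (c t) (velocity M c t)"
  shows "curve_length N d \<le> ereal k * curve_length M c"
proof -
  let ?g = "\<lambda>t. ennreal (tnorm N (d t) (velocity N d t)) * indicator {0<..<1} t"
  let ?f = "\<lambda>t. ennreal (tnorm M (c t) (velocity M c t)) * indicator {0<..<1} t"
  have "AE t in lborel. t \<notin> E"
    using \<open>finite E\<close> by (intro AE_not_in finite_imp_null_set_lborel)
  then have "AE t in lborel. ?g t \<le> ennreal k * ?f t"
  proof (rule eventually_mono)
    fix t assume "t \<notin> E"
    then show "?g t \<le> ennreal k * ?f t"
      using speed[of t] \<open>0 < k\<close>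
      by (cases "t \<in> {0<..<1}") (simp_all add: ennreal_mult'[symmetric] ennreal_leI)
  qed
  then have "integral\<^sup>N lborel ?g \<le> ennreal k * integral\<^sup>N lborel ?f"
    by (rule nn_integral_scale_le[OF \<open>0 < k\<close>])
  then have "enn2ereal (integral\<^sup>N lborel ?g) \<le> enn2ereal (ennreal k * integral\<^sup>N lborel ?f)"
    by (simp add: less_eq_ennreal.rep_eq)
  then show ?thesis
    using \<open>0 < k\<close> unfolding curve_length_def by (simp add: times_ennreal.rep_eq enn2ereal_ennreal)
qed

lemma curve_length_nonneg: "0 \<le> curve_length M c"
  unfolding curve_length_def by simp

lemma dist_in_nonneg: "0 \<le> dist_in M S p q"
  unfolding dist_in_def by (intro INF_greatest curve_length_nonneg)

lemma curve_image_subset: "curve M c \<Longrightarrow> c ` {0..1} \<subseteq> topspace (mtop M)"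
  unfolding curve_def using continuous_map_image_subset_topspace by fastforce

lemma riem_dist_eq:
  "riem_dist M p q = (INF c\<in>{c. curve M c \<and> c 0 = p \<and> c 1 = q}. curve_length M c)"
proof -
  have "{c. curve M c \<and> c ` {0..1} \<subseteq> topspace (mtop M) \<and> c 0 = p \<and> c 1 = q} =
      {c. curve M c \<and> c 0 = p \<and> c 1 = q}"
    using curve_image_subset by blast
  then show ?thesis
    unfolding riem_dist_def dist_in_def by simp
qed

lemma times_real_simps:
  "mtop (times_real W) = prod_topology (mtop W) euclideanreal"
  "charts (times_real W) = charts W"
  "p \<in> dom (times_real W) i \<longleftrightarrow> fst p \<in> dom W i"
  "chart (times_real W) i p = (chart W i (fst p), snd p)"
  "metric (times_real W) i p v w = metric W i (fst p) (fst v) (fst w) + snd v * snd w"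
  by (auto simp: times_real_def case_prod_unfold mem_Times_iff)

text \<open>Both choices of a chart are made by the same predicate, hence agree. So velocities in \<open>W \<times> \<real>\<close> and in
  \<open>W\<close> are expressed in the same coordinates and can be compared directly.\<close>
lemma chart_at_times_real: "chart_at (times_real W) p = chart_at W (fst p)"
  unfolding chart_at_def times_real_simps ..

lemma tnorm_times_real: "tnorm (times_real W) p v = sqrt ((metric W (chart_at W (fst p)) (fst p) (fst v) (fst v)) + (snd v)\<^sup>2)"
  by (simp add: tnorm_def times_real_simps chart_at_times_real power2_eq_square)

context riemannian_manifold_with_boundary
begin

lemma curve_in_topspace:
  assumes "curve M c" "t \<in> {0..1}"
  shows "c t \<in> topspace (mtop M)"
  using curve_image_subset[OF assms(1)] assms(2) by blast

lemma has_velocity: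
  assumes c: "curve M c" and t: "t \<in> {0<..<1} - E"
    and E: "\<forall>t\<in>{0<..<1} - E. \<forall>i\<in>charts M. c t \<in> dom M i \<longrightarrow> (chart M i \<circ> c) differentiable (at t)"
  shows "((chart M (chart_at M (c t)) \<circ> c) has_vector_derivative velocity M c t) (at t)"
proof -
  have "c t \<in> topspace (mtop M)"
    using curve_in_topspace[OF c, of t] t by simp
  then show ?thesis
    using E t chart_at_in[of "c t"] by (simp add: velocity_def vector_derivative_works[symmetric])
qed

text \<open>Continuity is local, and on the domain of a chart \<open>F\<close> is its coordinate expression after the chart.\<close>
lemma differentiable_fun_continuous:
  assumes F: "differentiable_fun M F"
  shows "continuous_map (mtop M) euclideanreal F"
proof (rule pasting_lemma[of "charts M" "mtop M" "dom M" euclideanreal "\<lambda>i. F"])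
  fix i assume i: "i \<in> charts M"
  have "continuous_on (chart M i ` dom M i) (F \<circ> param M i)"
    using F i unfolding differentiable_fun_def by (intro differentiable_imp_continuous_on) simp
  then have "continuous_map (top_of_set (chart M i ` dom M i)) euclideanreal (F \<circ> param M i)"
    by simp
  then have "continuous_map (subtopology (mtop M) (dom M i)) euclideanreal ((F \<circ> param M i) \<circ> chart M i)"
    by (rule continuous_map_compose[OF homeomorphic_imp_continuous_map[OF chart_homeo[OF i]]])
  then show "continuous_map (subtopology (mtop M) (dom M i)) euclideanreal F"
    by (rule continuous_map_eq) (simp add: topspace_dom[OF i] param_chart[OF i] del: topspace_subtopology)
next
  show "openin (mtop M) (dom M i)" if "i \<in> charts M" for i
    using that by (rule dom_open)
  show "\<exists>j. j \<in> charts M \<and> x \<in> dom M j \<and> F x = F x" if "x \<in> topspace (mtop M)" for x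
    using that chart_at_in by blast
qed simp

lemma has_derivative_along_curve:
  assumes F: "differentiable_fun M F"
    and c: "continuous_map (top_of_set {0..1}) (mtop M) c" and t: "t \<in> {0<..<1::real}"
    and v: "((chart M (chart_at M (c t)) \<circ> c) has_vector_derivative v) (at t)"
  shows "((F \<circ> c) has_vector_derivative differential M F (c t) v) (at t)"
proof -
  let ?i = "chart_at M (c t)"
  have "c t \<in> topspace (mtop M)"
    using continuous_map_image_subset_topspace[OF c] t by auto
  note i = chart_at_in[OF this]
  have ev: "\<forall>\<^sub>F s in nhds t. c s \<in> dom M ?i"
    by (rule eventually_curve_in_open[OF c t dom_open[OF i(1)] i(2)])
  have "((F \<circ> param M ?i) has_derivative differential M F (c t))
      (at ((chart M ?i \<circ> c) t) within chart M ?i ` dom M ?i)"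
    using F i unfolding differentiable_fun_def differentiable_on_def differential_def Let_def
    by (simp add: frechet_derivative_works[symmetric])
  then have "((F \<circ> param M ?i) \<circ> (chart M ?i \<circ> c) has_vector_derivative differential M F (c t) v) (at t)"
    by (rule has_vector_derivative_compose_within[OF _ v]) (rule eventually_mono[OF ev], simp)
  then show ?thesis
    by (rule has_vector_derivative_cong_nhds) (rule eventually_mono[OF ev], simp add: param_chart[OF i(1)])
qed

text \<open>With \<open>s\<close> the speed of \<open>c\<close>, the lift has speed \<open>sqrt (s\<^sup>2 + (dF(c'))\<^sup>2) \<le> s + \<bar>dF(c')\<bar> \<le> (1 + G) s\<close>.\<close>
lemma lift_curve:
  assumes F: "differentiable_fun M F" and c: "curve M c"
    and G: "\<And>x. x \<in> topspace (mtop M) \<Longrightarrow> tnorm M x (gradient M F x) \<le> G" "0 \<le> G"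
  shows "curve (times_real M) (\<lambda>t. (c t, F (c t)))" (is "curve _ ?d")
    and "curve_length (times_real M) (\<lambda>t. (c t, F (c t))) \<le> ereal (1 + G) * curve_length M c"
proof -
  have cont: "continuous_map (top_of_set {0..1}) (mtop M) c"
    using c unfolding curve_def by simp
  obtain E where E: "finite E" "\<forall>t\<in>{0<..<1} - E. \<forall>i\<in>charts M. c t \<in> dom M i \<longrightarrow>
      (chart M i \<circ> c) differentiable (at t)"
    using c unfolding curve_def by blast
  have chart_d: "chart (times_real M) i \<circ> ?d = (\<lambda>t. ((chart M i \<circ> c) t, (F \<circ> c) t))" for i
    by (simp add: fun_eq_iff times_real_simps)
  have dF: "((F \<circ> c) has_vector_derivative differential M F (c t) (velocity M c t)) (at t)"
    if "t \<in> {0<..<1} - E" for t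
    using has_derivative_along_curve[OF F cont _ has_velocity[OF c that E(2)]] that by simp
  have "(chart (times_real M) i \<circ> ?d) differentiable (at t)"
    if t: "t \<in> {0<..<1} - E" and i: "i \<in> charts M" "c t \<in> dom M i" for t i
  proof -
    have "((chart M i \<circ> c) has_vector_derivative vector_derivative (chart M i \<circ> c) (at t)) (at t)"
      using E(2) t i by (simp add: vector_derivative_works[symmetric])
    from has_vector_derivative_Pair[OF this dF[OF t]] show ?thesis
      unfolding chart_d by (rule differentiableI_vector)
  qed
  moreover have "continuous_map (top_of_set {0..1}) euclideanreal (F \<circ> c)"
    by (rule continuous_map_compose[OF cont differentiable_fun_continuous[OF F]])
  then have "continuous_map (top_of_set {0..1}) (prod_topology (mtop M) euclideanreal) ?d"
    using cont by (simp add: continuous_map_pairwise o_def)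
  ultimately show "curve (times_real M) ?d"
    unfolding curve_def using E(1) by (auto simp: times_real_simps(1-3))
  show "curve_length (times_real M) ?d \<le> ereal (1 + G) * curve_length M c"
  proof (rule curve_length_scale_le[OF E(1)])
    show "0 < 1 + G" using G(2) by simp
    fix t assume t: "t \<in> {0<..<1} - E"
    let ?v = "velocity M c t"
    have ct: "c t \<in> topspace (mtop M)"
      using curve_in_topspace[OF c, of t] t by simp
    have "velocity (times_real M) ?d t = (?v, differential M F (c t) ?v)"
      unfolding velocity_def[of "times_real M"] chart_at_times_real chart_d fst_conv
      by (intro vector_derivative_at has_vector_derivative_Pair has_velocity[OF c t E(2)] dF[OF t])
    then have "tnorm (times_real M) (?d t) (velocity (times_real M) ?d t)
        = sqrt ((metric M (chart_at M (c t)) (c t) ?v ?v) + (differential M F (c t) ?v)\<^sup>2)"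
      by (simp add: tnorm_times_real)
    also have "metric M (chart_at M (c t)) (c t) ?v ?v = (tnorm M (c t) ?v)\<^sup>2"
      unfolding tnorm_def using metric_nonneg[OF chart_at_in[OF ct]] by simp
    also have "sqrt ((tnorm M (c t) ?v)\<^sup>2 + (differential M F (c t) ?v)\<^sup>2)
        \<le> \<bar>tnorm M (c t) ?v\<bar> + \<bar>differential M F (c t) ?v\<bar>"
      by (rule sqrt_sum_squares_le_sum_abs)
    also have "\<dots> \<le> tnorm M (c t) ?v + G * tnorm M (c t) ?v"
      using differential_le_gradient[OF F ct, of ?v] tnorm_nonneg[OF ct, of ?v]
        mult_right_mono[OF G(1)[OF ct] tnorm_nonneg[OF ct, of ?v]] by simp
    finally show "tnorm (times_real M) (?d t) (velocity (times_real M) ?d t)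
        \<le> (1 + G) * tnorm M (c t) ?v"
      by (simp add: distrib_right)
  qed
qed

text \<open>The product metric is the metric of the first component plus a square, so forgetting the second
  component of a velocity cannot increase its norm.\<close>
lemma project_curve:
  assumes d: "curve (times_real M) d"
  shows "curve M (fst \<circ> d)" and "curve_length M (fst \<circ> d) \<le> curve_length (times_real M) d"
proof -
  obtain E where E: "finite E" "\<forall>t\<in>{0<..<1} - E. \<forall>i\<in>charts M. fst (d t) \<in> dom M i \<longrightarrow>
      (chart (times_real M) i \<circ> d) differentiable (at t)"
    using d unfolding curve_def times_real_simps(1-3) by blast
  have cont: "continuous_map (top_of_set {0..1}) (mtop M) (fst \<circ> d)"
    using d unfolding curve_def times_real_simps(1) continuous_map_pairwise by simp
  have der: "((chart M i \<circ> (fst \<circ> d)) has_vector_derivative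
      fst (vector_derivative (chart (times_real M) i \<circ> d) (at t))) (at t)"
    if "t \<in> {0<..<1} - E" "i \<in> charts M" "fst (d t) \<in> dom M i" for t i
  proof -
    have "((chart (times_real M) i \<circ> d) has_vector_derivative
        vector_derivative (chart (times_real M) i \<circ> d) (at t)) (at t)"
      using E(2) that by (simp add: vector_derivative_works[symmetric])
    then have "((\<lambda>t. fst ((chart (times_real M) i \<circ> d) t)) has_vector_derivative
        fst (vector_derivative (chart (times_real M) i \<circ> d) (at t))) (at t)"
      by (rule bounded_linear.has_vector_derivative[OF bounded_linear_fst])
    moreover have "(\<lambda>t. fst ((chart (times_real M) i \<circ> d) t)) = chart M i \<circ> (fst \<circ> d)"
      by (simp add: fun_eq_iff times_real_simps)
    ultimately show ?thesis by simp
  qed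
  show c: "curve M (fst \<circ> d)"
    unfolding curve_def using cont E(1) differentiableI_vector[OF der]
    by (auto intro!: exI[of _ E])
  have "curve_length M (fst \<circ> d) \<le> ereal 1 * curve_length (times_real M) d"
  proof (rule curve_length_scale_le[OF E(1)])
    fix t assume t: "t \<in> {0<..<1} - E"
    let ?i = "chart_at M (fst (d t))" and ?v = "velocity (times_real M) d t"
    have "fst (d t) \<in> topspace (mtop M)"
      using curve_in_topspace[OF c, of t] t by simp
    note i = chart_at_in[OF this]
    have "velocity M (fst \<circ> d) t = fst ?v"
      using vector_derivative_at[OF der[OF t i]] by (simp add: velocity_def chart_at_times_real)
    then show "tnorm M ((fst \<circ> d) t) (velocity M (fst \<circ> d) t)
        \<le> 1 * tnorm (times_real M) (d t) ?v"
      by (simp add: tnorm_times_real) (simp add: tnorm_def)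
  qed simp
  then show "curve_length M (fst \<circ> d) \<le> curve_length (times_real M) d"
    by (simp add: one_ereal_def[symmetric])
qed

lemma riem_dist_le_times_real: "riem_dist M (fst p) (fst q) \<le> riem_dist (times_real M) p q"
  unfolding riem_dist_eq[of "times_real M"]
proof (rule INF_greatest)
  fix d assume "d \<in> {d. curve (times_real M) d \<and> d 0 = p \<and> d 1 = q}"
  then show "riem_dist M (fst p) (fst q) \<le> curve_length (times_real M) d"
    unfolding riem_dist_eq
    using project_curve[of d] by (intro INF_lower2[of "fst \<circ> d"]) auto
qed

lemma dist_in_graph_le:
  assumes F: "differentiable_fun M F"
    and G: "\<And>x. x \<in> topspace (mtop M) \<Longrightarrow> tnorm M x (gradient M F x) \<le> G" "0 \<le> G"
  shows "dist_in (times_real M) (graph_of M F) (x, F x) (y, F y) \<le> ereal (1 + G) * riem_dist M x y"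
proof -
  have "dist_in (times_real M) (graph_of M F) (x, F x) (y, F y) / ereal (1 + G) \<le> riem_dist M x y"
    unfolding riem_dist_eq
  proof (rule INF_greatest)
    fix c assume "c \<in> {c. curve M c \<and> c 0 = x \<and> c 1 = y}"
    then have c: "curve M c" "c 0 = x" "c 1 = y" by auto
    have "dist_in (times_real M) (graph_of M F) (x, F x) (y, F y)
        \<le> curve_length (times_real M) (\<lambda>t. (c t, F (c t)))"
      unfolding dist_in_def
      using c lift_curve(1)[OF F c(1) G] curve_in_topspace[OF c(1)]
      by (intro INF_lower) (auto simp: graph_of_def)
    also have "\<dots> \<le> ereal (1 + G) * curve_length M c"
      by (rule lift_curve(2)[OF F c(1) G])
    finally show "dist_in (times_real M) (graph_of M F) (x, F x) (y, F y) / ereal (1 + G) \<le> curve_length M c"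
      using G(2) by (subst ereal_divide_le_pos) auto
  qed
  then show ?thesis
    using G(2) by (subst (asm) ereal_divide_le_pos) auto
qed

end

section \<open>Finiteness of the distance on a connected manifold\<close>

text \<open>The speed bound is stated in some chart, not through \<open>velocity\<close>, whose choice of chart would have
  to be tracked through every reparametrization. By chart independence it bounds the speed itself.\<close>
definition bounded_speed_path :: "('a, 'i, 'm::euclidean_space) riem_data \<Rightarrow> (real \<Rightarrow> 'a) \<Rightarrow> bool" where
  "bounded_speed_path M c \<longleftrightarrow> continuous_map (top_of_set {0..1}) (mtop M) c \<and>
     (\<exists>E K. finite E \<and> (\<forall>t\<in>{0<..<1} - E. \<exists>i\<in>charts M. \<exists>v. c t \<in> dom M i \<and>
        ((chart M i \<circ> c) has_vector_derivative v) (at t) \<and> metric M i (c t) v v \<le> K))"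

definition joined :: "('a, 'i, 'm::euclidean_space) riem_data \<Rightarrow> 'a \<Rightarrow> 'a \<Rightarrow> bool" where
  "joined M x y \<longleftrightarrow> (\<exists>c. bounded_speed_path M c \<and> c 0 = x \<and> c 1 = y)"

context riemannian_manifold_with_boundary
begin

lemma bounded_speed_path_finite_length:
  assumes "bounded_speed_path M c"
  shows "curve M c" and "curve_length M c < \<infinity>"
proof -
  have c: "continuous_map (top_of_set {0..1}) (mtop M) c"
    using assms unfolding bounded_speed_path_def by simp
  obtain E K where E: "finite E" and EK: "\<And>t. t \<in> {0<..<1} - E \<Longrightarrow> \<exists>i\<in>charts M. \<exists>v. c t \<in> dom M i \<and>
        ((chart M i \<circ> c) has_vector_derivative v) (at t) \<and> metric M i (c t) v v \<le> K"
    using assms unfolding bounded_speed_path_def by blast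
  have speed: "tnorm M (c t) (velocity M c t) \<le> sqrt K"
    and diff: "\<forall>j\<in>charts M. c t \<in> dom M j \<longrightarrow> (chart M j \<circ> c) differentiable (at t)"
    if t: "t \<in> {0<..<1} - E" for t
  proof -
    obtain i v where i: "i \<in> charts M" "c t \<in> dom M i"
      and v: "((chart M i \<circ> c) has_vector_derivative v) (at t)" and K: "metric M i (c t) v v \<le> K"
      using EK[OF t] by blast
    have t': "t \<in> {0<..<1}" using t by simp
    show "tnorm M (c t) (velocity M c t) \<le> sqrt K"
      using speed_in_chart(1)[OF c t' i v] K by simp
    show "\<forall>j\<in>charts M. c t \<in> dom M j \<longrightarrow> (chart M j \<circ> c) differentiable (at t)"
      using speed_in_chart(2)[OF c t' i v] by simp
  qed
  show "curve M c"
    unfolding curve_def using c E diff by blast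
  have "AE t in lborel. t \<notin> E"
    using E by (intro AE_not_in finite_imp_null_set_lborel)
  then have "(\<integral>\<^sup>+t\<in>{0<..<1}. ennreal (tnorm M (c t) (velocity M c t)) \<partial>lborel)
      \<le> (\<integral>\<^sup>+t. ennreal (sqrt K) * indicator {0<..<1::real} t \<partial>lborel)"
  proof (intro nn_integral_mono_AE, elim eventually_mono)
    fix t assume "t \<notin> E"
    then show "ennreal (tnorm M (c t) (velocity M c t)) * indicator {0<..<1} t
        \<le> ennreal (sqrt K) * indicator {0<..<1} t"
      using speed[of t] by (cases "t \<in> {0<..<1}") (auto intro: ennreal_leI)
  qed
  also have "\<dots> = ennreal (sqrt K)"
    by (subst nn_integral_cmult_indicator) auto
  finally have "(\<integral>\<^sup>+t\<in>{0<..<1}. ennreal (tnorm M (c t) (velocity M c t)) \<partial>lborel) < \<infinity>"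
    by (rule order_le_less_trans) simp
  then show "curve_length M c < \<infinity>"
    unfolding curve_length_def by (simp add: less_ennreal.rep_eq)
qed

lemma joined_riem_dist: "joined M x y \<Longrightarrow> riem_dist M x y < \<infinity>"
  unfolding joined_def riem_dist_eq using bounded_speed_path_finite_length
  by (auto simp: INF_less_iff simp del: ereal_infty_less)

lemma joined_trans:
  assumes "joined M x y" "joined M y z"
  shows "joined M x z"
proof -
  obtain c1 c2 where c1: "bounded_speed_path M c1" "c1 0 = x" "c1 1 = y"
    and c2: "bounded_speed_path M c2" "c2 0 = y" "c2 1 = z"
    using assms unfolding joined_def by blast
  define c where "c t = (if t \<le> 1 / 2 then c1 (2 * t) else c2 (2 * t - 1))" for t
  \<comment> \<open>The bound is on the squared speed, which is multiplied by \<open>4\<close> when a path is run through twice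
  as fast.\<close>
  define P where "P d K t \<longleftrightarrow> (\<exists>i\<in>charts M. \<exists>v. d t \<in> dom M i \<and>
        ((chart M i \<circ> d) has_vector_derivative v) (at t) \<and> metric M i (d t) v v \<le> K)" for d K t
  have reparam: "P c (4 * K) t" if P: "P d K (2 * t - b)" and ev: "\<forall>\<^sub>F s in nhds t. c s = d (2 * s - b)"
    for d K t b
  proof -
    obtain i v where i: "i \<in> charts M" "d (2 * t - b) \<in> dom M i"
      and v: "((chart M i \<circ> d) has_vector_derivative v) (at (2 * t - b))"
      and K: "metric M i (d (2 * t - b)) v v \<le> K"
      using P unfolding P_def by blast
    have ct: "c t = d (2 * t - b)"
      using eventually_nhds_x_imp_x[OF ev] .
    have "((chart M i \<circ> c) has_vector_derivative 2 *\<^sub>R v) (at t)"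
      by (rule has_vector_derivative_affine_reparam[OF v]) (rule eventually_mono[OF ev], simp)
    moreover have "metric M i (c t) (2 *\<^sub>R v) (2 *\<^sub>R v) \<le> 4 * K"
      unfolding ct using K linear_scale[OF metric_linear(1)[OF i]] linear_scale[OF metric_linear(2)[OF i]]
      by simp
    ultimately show ?thesis
      unfolding P_def using i ct by auto
  qed
  obtain E1 K1 where E1: "finite E1" and K1: "\<And>t. t \<in> {0<..<1} - E1 \<Longrightarrow> P c1 K1 t"
    using c1(1) unfolding bounded_speed_path_def P_def by blast
  obtain E2 K2 where E2: "finite E2" and K2: "\<And>t. t \<in> {0<..<1} - E2 \<Longrightarrow> P c2 K2 t"
    using c2(1) unfolding bounded_speed_path_def P_def by blast
  define E where "E = {1 / 2} \<union> (\<lambda>t. t / 2) ` E1 \<union> (\<lambda>t. (t + 1) / 2) ` E2"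
  have mono: "P c K t \<Longrightarrow> K \<le> K' \<Longrightarrow> P c K' t" for K K' t
    unfolding P_def by (meson order_trans)
  have "P c (max (4 * K1) (4 * K2)) t" if t: "t \<in> {0<..<1} - E" for t
  proof (cases "t < 1 / 2")
    case True
    have "2 * t \<notin> E1"
    proof
      assume "2 * t \<in> E1"
      then have "2 * t / 2 \<in> E"
        unfolding E_def by blast
      with t show False by simp
    qed
    then have "P c1 K1 (2 * t - 0)"
      using K1[of "2 * t"] t True by simp
    moreover have "\<forall>\<^sub>F s in nhds t. s \<in> {..<1 / 2}"
      by (rule eventually_nhds_in_open) (use True in auto)
    then have "\<forall>\<^sub>F s in nhds t. c s = c1 (2 * s - 0)"
      by (rule eventually_mono) (simp add: c_def)
    ultimately have "P c (4 * K1) t" by (rule reparam)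
    then show ?thesis by (rule mono) simp
  next
    case False
    with t have t2: "1 / 2 < t"
      unfolding E_def by (cases "t = 1 / 2") auto
    have "2 * t - 1 \<notin> E2"
    proof
      assume "2 * t - 1 \<in> E2"
      then have "(2 * t - 1 + 1) / 2 \<in> E"
        unfolding E_def by blast
      with t show False by simp
    qed
    then have "P c2 K2 (2 * t - 1)"
      using K2[of "2 * t - 1"] t t2 by simp
    moreover have "\<forall>\<^sub>F s in nhds t. s \<in> {1 / 2<..}"
      by (rule eventually_nhds_in_open) (use t2 in auto)
    then have "\<forall>\<^sub>F s in nhds t. c s = c2 (2 * s - 1)"
      by (rule eventually_mono) (simp add: c_def)
    ultimately have "P c (4 * K2) t" by (rule reparam)
    then show ?thesis by (rule mono) simp
  qed
  moreover have "finite E"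
    using E1 E2 by (simp add: E_def)
  moreover have "continuous_map (top_of_set {0..1}) (mtop M) c"
    unfolding c_def
  proof (rule continuous_map_cases_le)
    have 1: "continuous_map (top_of_set {0..1}) (mtop M) c1" "continuous_map (top_of_set {0..1}) (mtop M) c2"
      using c1(1) c2(1) unfolding bounded_speed_path_def by auto
    have "continuous_map (subtopology (top_of_set {0..1}) {t \<in> topspace (top_of_set {0..1}). t \<le> 1 / 2})
        (top_of_set {0..1}) (\<lambda>t. 2 * t :: real)"
      by (auto simp: subtopology_subtopology continuous_map_in_subtopology intro!: continuous_intros)
    from continuous_map_compose[OF this 1(1)]
    show "continuous_map (subtopology (top_of_set {0..1}) {t \<in> topspace (top_of_set {0..1}). t \<le> 1 / 2})
        (mtop M) (\<lambda>t. c1 (2 * t))"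
      by (simp add: o_def)
    have "continuous_map (subtopology (top_of_set {0..1}) {t \<in> topspace (top_of_set {0..1}). 1 / 2 \<le> t})
        (top_of_set {0..1}) (\<lambda>t. 2 * t - 1 :: real)"
      by (auto simp: subtopology_subtopology continuous_map_in_subtopology intro!: continuous_intros)
    from continuous_map_compose[OF this 1(2)]
    show "continuous_map (subtopology (top_of_set {0..1}) {t \<in> topspace (top_of_set {0..1}). 1 / 2 \<le> t})
        (mtop M) (\<lambda>t. c2 (2 * t - 1))"
      by (simp add: o_def)
    show "c1 (2 * t) = c2 (2 * t - 1)" if "t = 1 / 2" for t
      unfolding that using c1(3) c2(2) by simp
  qed (auto intro!: continuous_intros)
  ultimately have "bounded_speed_path M c"
    unfolding bounded_speed_path_def P_def by blast
  moreover have "c 0 = x" "c 1 = z"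
    using c1(2) c2(3) by (simp_all add: c_def)
  ultimately show ?thesis
    unfolding joined_def by blast
qed

lemma chart_image_contains_cball:
  assumes i: "i \<in> charts M" and p: "p \<in> dom M i"
  obtains a e where "0 < e" "a \<noteq> 0" "0 \<le> a \<bullet> chart M i p"
    and "cball (chart M i p) e \<inter> {v. 0 \<le> a \<bullet> v} \<subseteq> chart M i ` dom M i"
    and "chart M i ` dom M i \<subseteq> {v. 0 \<le> a \<bullet> v}"
proof -
  obtain a where a: "a \<noteq> 0" "openin (top_of_set {v. 0 \<le> a \<bullet> v}) (chart M i ` dom M i)"
    using chart_image[OF i] by blast
  have sub: "chart M i ` dom M i \<subseteq> {v. 0 \<le> a \<bullet> v}"
    using openin_imp_subset[OF a(2)] .
  obtain e where "0 < e" "cball (chart M i p) e \<inter> {v. 0 \<le> a \<bullet> v} \<subseteq> chart M i ` dom M i"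
    using a(2) p unfolding openin_contains_cball by blast
  with a(1) sub p show thesis
    using that by blast
qed

text \<open>The velocity of a straight segment is constant in coordinates, and the metric is continuous, so the
  squared speed is a continuous function on a compact interval.\<close>
lemma joined_segment:
  assumes i: "i \<in> charts M" and zw: "z \<in> dom M i" "w \<in> dom M i"
    and seg: "closed_segment (chart M i z) (chart M i w) \<subseteq> chart M i ` dom M i"
  shows "joined M z w"
proof -
  let ?u = "chart M i z" and ?v = "chart M i w"
  define l where "l t = ?u + t *\<^sub>R (?v - ?u)" for t :: real
  define c where "c = param M i \<circ> l"
  have l: "l t \<in> chart M i ` dom M i" if "t \<in> {0..1}" for t
  proof -
    have "l t \<in> closed_segment ?u ?v"
      using that by (auto simp: in_segment l_def algebra_simps intro!: exI[of _ t])
    with seg show ?thesis by blast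
  qed
  have l_cont: "continuous_on {0..1} l"
    unfolding l_def by (intro continuous_intros)
  have "continuous_map (top_of_set {0..1}) (top_of_set (chart M i ` dom M i)) l"
    using l l_cont by (auto simp: continuous_map_in_subtopology)
  then have c: "continuous_map (top_of_set {0..1}) (mtop M) c"
    unfolding c_def by (rule continuous_map_compose[OF _ param_continuous[OF i]])
  let ?K = "\<lambda>t. metric M i (param M i (l t)) (?v - ?u) (?v - ?u)"
  have "continuous_on {0..1} ?K"
    by (rule continuous_on_compose2[OF metric_continuous[OF i] l_cont]) (use l in blast)
  then have "compact (?K ` {0..1})"
    by (rule compact_continuous_image) simp
  then obtain K where K: "\<And>t. t \<in> {0..1} \<Longrightarrow> ?K t \<le> K"
    using bounded_imp_bdd_above[OF compact_imp_bounded] by (force simp: bdd_above_def)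
  have "\<exists>i\<in>charts M. \<exists>v. c t \<in> dom M i \<and>
        ((chart M i \<circ> c) has_vector_derivative v) (at t) \<and> metric M i (c t) v v \<le> K"
    if t: "t \<in> {0<..<1} - {}" for t
  proof (intro bexI exI conjI)
    have "(l has_vector_derivative (?v - ?u)) (at t)"
      unfolding l_def by (auto intro!: derivative_eq_intros)
    moreover have "\<forall>\<^sub>F s in nhds t. s \<in> {0<..<1}"
      by (rule eventually_nhds_in_open) (use t in auto)
    then have "\<forall>\<^sub>F s in nhds t. l s = (chart M i \<circ> c) s"
      by (rule eventually_mono) (simp add: c_def chart_param[OF l])
    ultimately show "((chart M i \<circ> c) has_vector_derivative (?v - ?u)) (at t)"
      by (rule has_vector_derivative_cong_nhds)
    show "c t \<in> dom M i"
      using param_in_dom[OF l, of t] t by (simp add: c_def)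
    show "metric M i (c t) (?v - ?u) (?v - ?u) \<le> K"
      using K[of t] t by (simp add: c_def)
  qed (rule i)
  then have "bounded_speed_path M c"
    unfolding bounded_speed_path_def using c by blast
  moreover have "c 0 = z" "c 1 = w"
    using param_chart[OF i] zw by (simp_all add: c_def l_def)
  ultimately show ?thesis
    unfolding joined_def by blast
qed

text \<open>A ball in the closed half-space is convex, also around a boundary point, so a small coordinate ball
  contains the coordinate segments between its points.\<close>
lemma locally_joined:
  assumes "y \<in> topspace (mtop M)"
  obtains U where "openin (mtop M) U" "y \<in> U" "\<And>z w. \<lbrakk>z \<in> U; w \<in> U\<rbrakk> \<Longrightarrow> joined M z w"
proof -
  let ?i = "chart_at M y"
  note i = chart_at_in[OF assms]
  let ?im = "chart M ?i ` dom M ?i"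
  obtain a e where e: "0 < e" and cb: "cball (chart M ?i y) e \<inter> {v. 0 \<le> a \<bullet> v} \<subseteq> ?im"
    and im: "?im \<subseteq> {v. 0 \<le> a \<bullet> v}"
    using chart_image_contains_cball[OF i] by metis
  let ?U = "{p \<in> dom M ?i. chart M ?i p \<in> ball (chart M ?i y) e}"
  show thesis
  proof (rule that)
    show "openin (mtop M) ?U"
      by (rule openin_chart_preimage[OF i(1)]) simp
    show "y \<in> ?U"
      using i e by simp
    fix z w assume zw: "z \<in> ?U" "w \<in> ?U"
    have "convex (cball (chart M ?i y) e \<inter> {v. 0 \<le> a \<bullet> v})"
      by (intro convex_Int convex_cball convex_halfspace_ge)
    moreover have "chart M ?i z \<in> cball (chart M ?i y) e \<inter> {v. 0 \<le> a \<bullet> v}"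
      "chart M ?i w \<in> cball (chart M ?i y) e \<inter> {v. 0 \<le> a \<bullet> v}"
      using zw im by auto
    ultimately have "closed_segment (chart M ?i z) (chart M ?i w) \<subseteq> cball (chart M ?i y) e \<inter> {v. 0 \<le> a \<bullet> v}"
      by (rule closed_segment_subset[rotated 2])
    with cb show "joined M z w"
      using zw by (intro joined_segment[OF i(1)]) auto
  qed
qed

text \<open>By local joining, the set of points joined to \<open>x\<close> and its complement are both open.\<close>
lemma connected_imp_joined:
  assumes conn: "connected_space (mtop M)" and x: "x \<in> topspace (mtop M)" and y: "y \<in> topspace (mtop M)"
  shows "joined M x y"
proof -
  let ?X = "topspace (mtop M)"
  define R where "R = {z \<in> ?X. joined M x z}"
  have nbhd: "\<exists>U. openin (mtop M) U \<and> z \<in> U \<and> (U \<subseteq> R \<or> U \<inter> R = {})" if z: "z \<in> ?X" for z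
  proof -
    obtain U where U: "openin (mtop M) U" "z \<in> U" "\<And>z w. \<lbrakk>z \<in> U; w \<in> U\<rbrakk> \<Longrightarrow> joined M z w"
      using locally_joined[OF z] by metis
    have "U \<subseteq> ?X" using U(1) by (rule openin_subset)
    then have "U \<subseteq> R" if "U \<inter> R \<noteq> {}"
      using that U(3) joined_trans unfolding R_def by blast
    with U show ?thesis by blast
  qed
  have "openin (mtop M) R"
  proof (subst openin_subopen, safe)
    fix z assume z: "z \<in> R"
    then have "z \<in> ?X" unfolding R_def by simp
    from nbhd[OF this] z show "\<exists>T. openin (mtop M) T \<and> z \<in> T \<and> T \<subseteq> R" by blast
  qed
  moreover have "openin (mtop M) (?X - R)"
  proof (subst openin_subopen, rule ballI)
    fix z assume z: "z \<in> ?X - R"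
    then have "z \<in> ?X" by simp
    from nbhd[OF this] z show "\<exists>T. openin (mtop M) T \<and> z \<in> T \<and> T \<subseteq> ?X - R"
      using openin_subset by blast
  qed
  then have "closedin (mtop M) R"
    unfolding closedin_def R_def by simp
  ultimately have "R = {} \<or> R = ?X"
    using conn unfolding connected_space_clopen_in by blast
  moreover have "x \<in> R"
    using locally_joined[OF x] x unfolding R_def by (metis (mono_tags, lifting) mem_Collect_eq)
  ultimately show ?thesis
    using y unfolding R_def by blast
qed

section \<open>Positivity of the diameter\<close>

lemma metric_expand:
  assumes "i \<in> charts M" "p \<in> dom M i"
  shows "metric M i p v w = (\<Sum>b\<in>Basis. \<Sum>b'\<in>Basis. (v \<bullet> b) * (w \<bullet> b') * metric M i p b b')"
proof -
  note lin = metric_linear[OF assms]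
  have "metric M i p v w = metric M i p (\<Sum>b\<in>Basis. (v \<bullet> b) *\<^sub>R b) (\<Sum>b\<in>Basis. (w \<bullet> b) *\<^sub>R b)"
    by (simp add: euclidean_representation)
  also have "\<dots> = (\<Sum>b\<in>Basis. \<Sum>b'\<in>Basis. (v \<bullet> b) * (w \<bullet> b') * metric M i p b b')"
    unfolding linear_sum[OF lin(2)] linear_scale[OF lin(2)] linear_sum[OF lin(1)] linear_scale[OF lin(1)]
    by (subst sum.swap) (simp add: sum_distrib_left mult_ac)
  finally show ?thesis .
qed

text \<open>The squared norm is continuous and positive on the compact set of pairs \<open>(u, v)\<close> with \<open>u \<in> K\<close> and \<open>v\<close>
  of Euclidean norm \<open>1\<close>, so it has a positive minimum; then use homogeneity.\<close>
lemma metric_bounded_below: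
  assumes i: "i \<in> charts M" and K: "compact K" "K \<subseteq> chart M i ` dom M i"
  obtains l where "0 < l" "\<And>u v. u \<in> K \<Longrightarrow> l * norm v \<le> sqrt (metric M i (param M i u) v v)"
proof (cases "K = {}")
  case True
  then show thesis using that[of 1] by simp
next
  case False
  let ?S = "sphere (0::'m) 1"
  \<comment> \<open>The metric is only known to be continuous in the point for fixed vectors; expanding in a basis
  gives joint continuity.\<close>
  define g where "g x = (\<Sum>b\<in>Basis. \<Sum>b'\<in>Basis.
      (snd x \<bullet> b) * (snd x \<bullet> b') * metric M i (param M i (fst x)) b b')" for x
  have g: "g (u, v) = metric M i (param M i u) v v" if "u \<in> K" for u v
    using metric_expand[OF i param_in_dom, of u v v] that K(2) by (auto simp: g_def)
  have "continuous_on (K \<times> ?S) (\<lambda>x. metric M i (param M i (fst x)) b b')" for b b'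
    by (rule continuous_on_compose2[OF metric_continuous[OF i]]) (use K(2) in \<open>auto intro!: continuous_intros\<close>)
  then have "continuous_on (K \<times> ?S) g"
    unfolding g_def by (intro continuous_intros)
  moreover have "compact (K \<times> ?S)"
    using K(1) by (intro compact_Times) auto
  moreover have "K \<times> ?S \<noteq> {}"
    using False by simp
  ultimately obtain x where x: "x \<in> K \<times> ?S" and min: "\<And>y. y \<in> K \<times> ?S \<Longrightarrow> g x \<le> g y"
    using continuous_attains_inf by metis
  obtain u\<^sub>0 v\<^sub>0 where x': "x = (u\<^sub>0, v\<^sub>0)" "u\<^sub>0 \<in> K" "v\<^sub>0 \<in> ?S"
    using x by auto
  have "v\<^sub>0 \<noteq> 0" using x'(3) by auto
  then have pos: "0 < g x"
    using metric_pos[OF i param_in_dom, of u\<^sub>0 v\<^sub>0] x' K(2) g by auto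
  have le: "sqrt (g x) * norm v \<le> sqrt (metric M i (param M i u) v v)" if u: "u \<in> K" for u v
  proof (cases "v = 0")
    case False
    have dom: "param M i u \<in> dom M i"
      using u K(2) param_in_dom by blast
    define w where "w = v /\<^sub>R norm v"
    have w: "w \<in> ?S" "v = norm v *\<^sub>R w"
      using False by (simp_all add: w_def)
    have "metric M i (param M i u) v v = (norm v)\<^sup>2 * metric M i (param M i u) w w"
      by (subst (1 2) w(2)) (simp add: linear_scale[OF metric_linear(1)[OF i dom]]
          linear_scale[OF metric_linear(2)[OF i dom]] power2_eq_square del: scaleR_cancel_left)
    moreover have "g x \<le> metric M i (param M i u) w w"
      using min[of "(u, w)"] u w(1) g by simp
    ultimately have "(norm v)\<^sup>2 * g x \<le> metric M i (param M i u) v v"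
      by (simp add: mult_left_mono)
    then have "sqrt ((norm v)\<^sup>2 * g x) \<le> sqrt (metric M i (param M i u) v v)"
      by (rule real_sqrt_le_mono)
    then show ?thesis
      by (simp add: real_sqrt_mult mult.commute)
  qed (use metric_nonneg[OF i param_in_dom] u K(2) in auto)
  show thesis
    by (rule that[of "sqrt (g x)"]) (use pos le in auto)
qed

text \<open>A function whose derivative along a curve is at most \<open>L\<close> times the speed changes by at most
  \<open>L\<close> times the length. This bounds lengths from below.\<close>
lemma abs_diff_le_curve_length:
  assumes c: "curve M c" and "0 < L" and f: "continuous_map (mtop M) euclideanreal f"
    and bound: "\<And>t. \<lbrakk>t \<in> {0<..<1}; \<And>j. \<lbrakk>j \<in> charts M; c t \<in> dom M j\<rbrakk> \<Longrightarrow> (chart M j \<circ> c) differentiable (at t)\<rbrakk> \<Longrightarrow>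
      \<exists>d. ((f \<circ> c) has_vector_derivative d) (at t) \<and> \<bar>d\<bar> \<le> L * tnorm M (c t) (velocity M c t)"
  shows "ereal \<bar>f (c 1) - f (c 0)\<bar> \<le> ereal L * curve_length M c"
proof -
  let ?s = "\<lambda>t. tnorm M (c t) (velocity M c t)"
  obtain E where E: "finite E" "\<forall>t\<in>{0<..<1} - E. \<forall>i\<in>charts M. c t \<in> dom M i \<longrightarrow>
      (chart M i \<circ> c) differentiable (at t)"
    and cont: "continuous_map (top_of_set {0..1}) (mtop M) c"
    using c unfolding curve_def by blast
  have "continuous_on {0..1} (f \<circ> c)"
    using continuous_map_compose[OF cont f] by simp
  then have "ennreal \<bar>(f \<circ> c) 1 - (f \<circ> c) 0\<bar> \<le> (\<integral>\<^sup>+t\<in>{0<..<1}. ennreal (L * ?s t) \<partial>lborel)"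
  proof (rule abs_diff_le_nn_integral[OF E(1)])
    fix t assume t: "t \<in> {0<..<1} - E"
    then obtain d where "((f \<circ> c) has_vector_derivative d) (at t)" "\<bar>d\<bar> \<le> L * ?s t"
      using bound[of t] E(2) by auto
    then show "\<exists>d. ((f \<circ> c) has_vector_derivative d) (at t) \<and> ennreal \<bar>d\<bar> \<le> ennreal (L * ?s t)"
      using ennreal_leI by blast
  qed
  also have "\<dots> \<le> ennreal L * (\<integral>\<^sup>+t\<in>{0<..<1}. ennreal (?s t) \<partial>lborel)"
    by (rule nn_integral_scale_le[OF \<open>0 < L\<close>])
      (use \<open>0 < L\<close> in \<open>simp add: ennreal_mult' mult.assoc\<close>)
  finally have "enn2ereal (ennreal \<bar>f (c 1) - f (c 0)\<bar>) \<le>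
      enn2ereal (ennreal L * (\<integral>\<^sup>+t\<in>{0<..<1}. ennreal (?s t) \<partial>lborel))"
    by (simp add: less_eq_ennreal.rep_eq)
  then show ?thesis
    using \<open>0 < L\<close> unfolding curve_length_def by (simp add: times_ennreal.rep_eq enn2ereal_ennreal)
qed

text \<open>A curve from the centre of a coordinate ball of radius \<open>e\<close> to its boundary cannot be short. The witness
  is the bump function equal to \<open>(e\<^sup>2 - \<bar>w - u\<bar>\<^sup>2)\<^sup>2\<close> inside the coordinate ball around \<open>u\<close> and \<open>0\<close> elsewhere:
  it drops from \<open>e\<^sup>4\<close> to \<open>0\<close> and, its support being compact, has bounded gradient. The curve may leave the
  ball and even the chart; as the space is Hausdorff the support is closed, so the function is
  locally zero there.\<close>
lemma chart_bump_function:
  assumes i: "i \<in> charts M" and e: "0 < e"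
    and K: "compact K" "K \<subseteq> chart M i ` dom M i" "cball u e \<inter> chart M i ` dom M i \<subseteq> K"
  obtains L where "0 < L"
    and "\<And>c. curve M c \<Longrightarrow> c 0 \<in> dom M i \<Longrightarrow> c 1 \<in> dom M i \<Longrightarrow> chart M i (c 0) = u \<Longrightarrow>
      dist u (chart M i (c 1)) = e \<Longrightarrow> ereal (e ^ 4) \<le> ereal L * curve_length M c"
proof -
  obtain l where l: "0 < l" "\<And>u v. u \<in> K \<Longrightarrow> l * norm v \<le> sqrt (metric M i (param M i u) v v)"
    using metric_bounded_below[OF i K(1,2)] by metis
  define h where "h w = e\<^sup>2 - (w - u) \<bullet> (w - u)" for w
  define f where "f p = (if p \<in> dom M i then (max 0 (h (chart M i p)))\<^sup>2 else 0)" for p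
  have h_outside: "h w \<le> 0" if "w \<notin> cball u e" for w
  proof -
    have "e \<le> norm (w - u)" using that by (simp add: dist_norm norm_minus_commute)
    then have "e\<^sup>2 \<le> (norm (w - u))\<^sup>2" using e by (intro power_mono) auto
    then show ?thesis by (simp add: h_def power2_norm_eq_inner)
  qed
  define Z where "Z = param M i ` K"
  have "compactin (mtop M) Z"
    unfolding Z_def by (rule image_compactin[OF _ param_continuous[OF i]])
      (use K in \<open>simp add: compactin_subtopology\<close>)
  then have "closedin (mtop M) Z"
    by (rule compactin_imp_closedin[OF hausdorff])
  then have Z_open: "openin (mtop M) (topspace (mtop M) - Z)"
    by (simp add: openin_diff)
  have f_outside: "f p = 0" if "p \<notin> Z" for p
  proof (cases "p \<in> dom M i")
    case True
    have "chart M i p \<notin> cball u e"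
    proof
      assume "chart M i p \<in> cball u e"
      then have "chart M i p \<in> K" using K(3) True by blast
      then have "p \<in> Z" unfolding Z_def using param_chart[OF i True] by force
      with that show False by simp
    qed
    then show ?thesis using h_outside by (simp add: f_def)
  qed (simp add: f_def)
  have Z_dom: "Z \<subseteq> dom M i"
    unfolding Z_def using K(2) param_in_dom by blast
  have f_cont: "continuous_map (mtop M) euclideanreal f"
  proof (rule pasting_lemma[of UNIV "mtop M" "\<lambda>b. if b then dom M i else topspace (mtop M) - Z" _ "\<lambda>b. f"])
    fix b :: bool
    show "openin (mtop M) (if b then dom M i else topspace (mtop M) - Z)"
      using Z_open dom_open[OF i] by simp
    have "continuous_map euclidean euclideanreal (\<lambda>w. (max 0 (h w))\<^sup>2)"
      unfolding h_def by (auto intro!: continuous_intros)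
    from continuous_map_compose[OF chart_continuous[OF i] this]
    have "continuous_map (subtopology (mtop M) (dom M i)) euclideanreal f"
      by (rule continuous_map_eq) (simp add: topspace_dom[OF i] f_def del: topspace_subtopology)
    moreover have "continuous_map (subtopology (mtop M) (topspace (mtop M) - Z)) euclideanreal f"
      by (rule continuous_map_eq[of _ _ "\<lambda>_. 0"]) (auto simp: f_outside)
    ultimately show "continuous_map (subtopology (mtop M) (if b then dom M i else topspace (mtop M) - Z))
        euclideanreal f"
      by simp
  next
    fix p assume "p \<in> topspace (mtop M)"
    then show "\<exists>b. b \<in> UNIV \<and> p \<in> (if b then dom M i else topspace (mtop M) - Z) \<and> f p = f p"
      using Z_dom by (auto intro: exI[of _ "p \<in> dom M i"])
  qed simp
  \<comment> \<open>The bump has Euclidean gradient of norm at most \<open>4 e\<^sup>2 \<cdot> e\<close>, and \<open>1 / l\<close> compares Euclidean to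
  Riemannian norms.\<close>
  define L where "L = 4 * e ^ 3 / l"
  have "0 < L" using e l(1) by (simp add: L_def)
  have main: "ereal (e ^ 4) \<le> ereal L * curve_length M c"
    if c: "curve M c" and c0: "c 0 \<in> dom M i" "chart M i (c 0) = u"
      and c1: "c 1 \<in> dom M i" "dist u (chart M i (c 1)) = e" for c
  proof -
    have cont: "continuous_map (top_of_set {0..1}) (mtop M) c"
      using c unfolding curve_def by blast
    have "(norm (chart M i (c 1) - u))\<^sup>2 = e\<^sup>2"
      using c1(2) by (simp add: dist_norm norm_minus_commute)
    then have "h (chart M i (c 1)) = 0"
      by (simp add: h_def power2_norm_eq_inner)
    then have "f (c 1) = 0" by (simp add: f_def)
    moreover have "f (c 0) = e ^ 4"
      using c0 by (simp add: f_def h_def)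
    moreover have "ereal \<bar>f (c 1) - f (c 0)\<bar> \<le> ereal L * curve_length M c"
    proof (rule abs_diff_le_curve_length[OF c \<open>0 < L\<close> f_cont])
      fix t :: real assume t: "t \<in> {0<..<1}"
        and diff: "\<And>j. \<lbrakk>j \<in> charts M; c t \<in> dom M j\<rbrakk> \<Longrightarrow> (chart M j \<circ> c) differentiable (at t)"
      have ct: "c t \<in> topspace (mtop M)"
        using curve_in_topspace[OF c, of t] t by simp
      show "\<exists>d. ((f \<circ> c) has_vector_derivative d) (at t) \<and> \<bar>d\<bar> \<le> L * tnorm M (c t) (velocity M c t)"
      proof (cases "c t \<in> dom M i")
        case True
        let ?w = "chart M i \<circ> c"
        define v where "v = vector_derivative ?w (at t)"
        have v: "(?w has_vector_derivative v) (at t)"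
          unfolding v_def using diff[OF i True] by (simp add: vector_derivative_works[symmetric])
        have speed: "tnorm M (c t) (velocity M c t) = sqrt (metric M i (c t) v v)"
          by (rule speed_in_chart(1)[OF cont t i True v])
        define d where "d = 2 * max 0 (h (?w t)) * (- (2 * ((?w t - u) \<bullet> v)))"
        have "((\<lambda>s. ?w s - u) has_vector_derivative v) (at t)"
          using has_vector_derivative_diff[OF v has_vector_derivative_const] by simp
        from bounded_bilinear.has_vector_derivative[OF bounded_bilinear_inner this this]
        have "((\<lambda>s. h (?w s)) has_vector_derivative - (2 * ((?w t - u) \<bullet> v))) (at t)"
          unfolding h_def by (auto intro!: derivative_eq_intros simp: inner_commute)
        then have "((\<lambda>s. h (?w s)) has_real_derivative - (2 * ((?w t - u) \<bullet> v))) (at t)"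
          by (simp add: has_real_derivative_iff_has_vector_derivative)
        from DERIV_chain2[OF has_real_derivative_square_pos_part this]
        have "((\<lambda>s. (max 0 (h (?w s)))\<^sup>2) has_vector_derivative d) (at t)"
          by (simp add: has_real_derivative_iff_has_vector_derivative d_def)
        moreover have "\<forall>\<^sub>F s in nhds t. c s \<in> dom M i"
          by (rule eventually_curve_in_open[OF cont t dom_open[OF i] True])
        then have "\<forall>\<^sub>F s in nhds t. (max 0 (h (?w s)))\<^sup>2 = (f \<circ> c) s"
          by (rule eventually_mono) (simp add: f_def)
        ultimately have "((f \<circ> c) has_vector_derivative d) (at t)"
          by (rule has_vector_derivative_cong_nhds)
        moreover have "\<bar>d\<bar> \<le> L * sqrt (metric M i (c t) v v)"
        proof (cases "?w t \<in> cball u e")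
          case in_ball: True
          then have "?w t \<in> K" using K(3) True by auto
          then have lv: "l * norm v \<le> sqrt (metric M i (c t) v v)"
            using l(2)[of "?w t" v] param_chart[OF i True] by simp
          have "\<bar>(?w t - u) \<bullet> v\<bar> \<le> norm (?w t - u) * norm v"
            by (rule Cauchy_Schwarz_ineq2)
          also have "\<dots> \<le> e * norm v"
            using in_ball by (intro mult_right_mono) (auto simp: dist_norm norm_minus_commute)
          finally have 1: "\<bar>(?w t - u) \<bullet> v\<bar> \<le> e * norm v" .
          have 2: "max 0 (h (?w t)) \<le> e\<^sup>2"
            by (simp add: h_def)
          have "\<bar>d\<bar> = 4 * (max 0 (h (?w t)) * \<bar>(?w t - u) \<bullet> v\<bar>)"
            by (simp add: d_def abs_mult)
          also have "\<dots> \<le> 4 * (e\<^sup>2 * (e * norm v))"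
            using 1 2 by (intro mult_left_mono mult_mono) auto
          also have "\<dots> = L * (l * norm v)"
            using l(1) by (simp add: L_def power2_eq_square power3_eq_cube)
          also have "\<dots> \<le> L * sqrt (metric M i (c t) v v)"
            using lv \<open>0 < L\<close> by (intro mult_left_mono) auto
          finally show ?thesis .
        next
          case False
          then have "d = 0"
            using h_outside[of "?w t"] by (simp add: d_def)
          then show ?thesis
            using \<open>0 < L\<close> metric_nonneg[OF i True, of v] by simp
        qed
        ultimately show ?thesis
          unfolding speed by blast
      next
        case False
        then have "c t \<in> topspace (mtop M) - Z"
          using ct Z_dom by blast
        then have "\<forall>\<^sub>F s in nhds t. c s \<in> topspace (mtop M) - Z"
          by (rule eventually_curve_in_open[OF cont t Z_open])
        then have "\<forall>\<^sub>F s in nhds t. 0 = (f \<circ> c) s"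
          by (rule eventually_mono) (simp add: f_outside)
        then have "((f \<circ> c) has_vector_derivative 0) (at t)"
          by (rule has_vector_derivative_cong_nhds[OF has_vector_derivative_const])
        then show ?thesis
          using \<open>0 < L\<close> tnorm_nonneg[OF ct] by (intro exI[of _ 0]) simp
      qed
    qed
    ultimately show ?thesis
      using e by simp
  qed
  show thesis
    by (rule that[OF \<open>0 < L\<close>]) (use main in blast)
qed

text \<open>The model space has positive dimension, so a nonempty manifold has points other than a given \<open>p\<close>
  near it. Moving from \<open>p\<close> in the inner normal direction \<open>a\<close> stays in the half-space and
  reaches the boundary of a small coordinate ball.\<close>
lemma riem_diam_pos:
  assumes "topspace (mtop M) \<noteq> {}"
  shows "0 < riem_diam M"
proof -
  obtain p where p: "p \<in> topspace (mtop M)" using assms by blast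
  let ?i = "chart_at M p" and ?u = "chart M (chart_at M p) p"
  note i = chart_at_in[OF p]
  obtain a e where e: "0 < e" and a: "a \<noteq> 0" "0 \<le> a \<bullet> ?u"
    and cb: "cball ?u e \<inter> {v. 0 \<le> a \<bullet> v} \<subseteq> chart M ?i ` dom M ?i"
    and im: "chart M ?i ` dom M ?i \<subseteq> {v. 0 \<le> a \<bullet> v}"
    using chart_image_contains_cball[OF i] .
  have "compact (cball ?u e \<inter> {v. 0 \<le> a \<bullet> v})"
    by (intro compact_Int_closed compact_cball closed_halfspace_ge)
  then obtain L where L: "0 < L" and len: "\<And>c. curve M c \<Longrightarrow> c 0 \<in> dom M ?i \<Longrightarrow> c 1 \<in> dom M ?i \<Longrightarrow>
      chart M ?i (c 0) = ?u \<Longrightarrow> dist ?u (chart M ?i (c 1)) = e \<Longrightarrow> ereal (e ^ 4) \<le> ereal L * curve_length M c"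
    using chart_bump_function[OF i(1) e _ cb] im by (metis Int_mono subset_refl)
  define w where "w = ?u + (e / norm a) *\<^sub>R a"
  have w: "dist ?u w = e"
    using a(1) e by (simp add: w_def dist_norm)
  moreover have "0 \<le> a \<bullet> w"
    using a e by (simp add: w_def inner_add_right)
  ultimately have "w \<in> chart M ?i ` dom M ?i"
    using cb by auto
  then obtain q where q: "q \<in> dom M ?i" "w = chart M ?i q" by blast
  have "ereal (e ^ 4 / L) \<le> riem_dist M p q"
    unfolding riem_dist_eq
  proof (rule INF_greatest)
    fix c assume "c \<in> {c. curve M c \<and> c 0 = p \<and> c 1 = q}"
    then have "ereal (e ^ 4) \<le> ereal L * curve_length M c"
      using len[of c] i(2) q w by auto
    then show "ereal (e ^ 4 / L) \<le> curve_length M c"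
      using L by (cases "curve_length M c") (auto simp: field_simps)
  qed
  also have "riem_dist M p q \<le> riem_diam M"
    unfolding riem_diam_def using p q(1) dom_subset[OF i(1)] by (intro SUP_upper2[of p] SUP_upper) auto
  finally have "ereal (e ^ 4 / L) \<le> riem_diam M" .
  moreover have "0 < ereal (e ^ 4 / L)" using e L by simp
  ultimately show ?thesis by (rule order_less_le_trans[rotated])
qed

section \<open>The embedding constant of a graph\<close>

lemma dist_in_graph_minus_le:
  assumes conn: "connected_space (mtop M)" and F: "differentiable_fun M F"
    and G: "\<And>x. x \<in> topspace (mtop M) \<Longrightarrow> tnorm M x (gradient M F x) \<le> G" "0 \<le> G"
    and xy: "x \<in> topspace (mtop M)" "y \<in> topspace (mtop M)"
  shows "dist_in (times_real M) (graph_of M F) (x, F x) (y, F y) - riem_dist (times_real M) (x, F x) (y, F y)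
    \<le> ereal G * riem_dist M x y"
proof -
  have "0 \<le> riem_dist M x y"
    unfolding riem_dist_def by (rule dist_in_nonneg)
  moreover have "riem_dist M x y < \<infinity>"
    by (rule joined_riem_dist[OF connected_imp_joined[OF conn xy]])
  ultimately obtain r where r: "riem_dist M x y = ereal r"
    by (cases "riem_dist M x y") auto
  have "dist_in (times_real M) (graph_of M F) (x, F x) (y, F y) - riem_dist (times_real M) (x, F x) (y, F y)
      \<le> ereal (1 + G) * riem_dist M x y - riem_dist M x y"
    using riem_dist_le_times_real[of "(x, F x)" "(y, F y)"]
    by (intro ereal_minus_mono dist_in_graph_le[OF F G]) auto
  also have "\<dots> = ereal G * riem_dist M x y"
    by (simp add: r algebra_simps)
  finally show ?thesis .
qed

end

theorem theorem3p6:
  fixes W :: "('a, 'i, 'm::euclidean_space) riem_data" and F :: "'a \<Rightarrow> real"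
  assumes "riemannian_manifold_with_boundary W"
    and "compact_space (mtop W)"
    and "connected_space (mtop W)"
    and "differentiable_fun W F"
  shows "embedding_constant (times_real W) (graph_of W F)
    \<le> 2 * riem_diam W * (SUP x\<in>topspace (mtop W). ereal (tnorm W x (gradient W F x)))"
proof (cases "topspace (mtop W) = {}")
  case True
  then have "graph_of W F = {}" by (simp add: graph_of_def)
  then show ?thesis by (simp add: embedding_constant_def bot_ereal_def)
next
  case False
  interpret riemannian_manifold_with_boundary W by fact
  let ?S = "SUP x\<in>topspace (mtop W). ereal (tnorm W x (gradient W F x))"
  have diam: "0 < riem_diam W" by (rule riem_diam_pos[OF False])
  obtain x\<^sub>0 where "x\<^sub>0 \<in> topspace (mtop W)" using False by blast
  then have S: "0 \<le> ?S"
    using tnorm_nonneg by (intro SUP_upper2[of "x\<^sub>0"]) auto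
  show ?thesis
  proof (cases "?S = \<infinity>")
    case True
    \<comment> \<open>Here positivity of the diameter excludes the product \<open>0 \<cdot> \<infinity> = 0\<close>.\<close>
    then have "2 * riem_diam W * ?S = \<infinity>"
      using diam by (cases "riem_diam W") auto
    then show ?thesis by (simp only: ereal_less_eq(1))
  next
    case False
    with S obtain G where G: "?S = ereal G" by (cases ?S) auto
    then have "0 \<le> G" using S by simp
    have grad: "tnorm W x (gradient W F x) \<le> G" if "x \<in> topspace (mtop W)" for x
      using SUP_upper[OF that, of "\<lambda>x. ereal (tnorm W x (gradient W F x))"] G by simp
    show ?thesis
      unfolding embedding_constant_def
    proof (intro SUP_least)
      fix p q assume "p \<in> graph_of W F" "q \<in> graph_of W F"
      then obtain x y where p: "p = (x, F x)" "x \<in> topspace (mtop W)"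
        and q: "q = (y, F y)" "y \<in> topspace (mtop W)"
        unfolding graph_of_def by blast
      have "dist_in (times_real W) (graph_of W F) p q - riem_dist (times_real W) p q
          \<le> ereal G * riem_dist W x y"
        unfolding p(1) q(1) by (rule dist_in_graph_minus_le[OF assms(3,4) grad \<open>0 \<le> G\<close> p(2) q(2)])
      also have "\<dots> \<le> ereal G * riem_diam W"
        unfolding riem_diam_def using p(2) q(2) \<open>0 \<le> G\<close>
        by (intro ereal_mult_left_mono SUP_upper2[of x] SUP_upper) auto
      also have "\<dots> \<le> 2 * riem_diam W * ?S"
        unfolding G using diam \<open>0 \<le> G\<close> by (cases "riem_diam W") (auto simp: mult.commute)
      finally show "dist_in (times_real W) (graph_of W F) p q - riem_dist (times_real W) p q
          \<le> 2 * riem_diam W * ?S" .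
    qed
  qed
qed

end
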